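(* Let $X=\{X_t,\ t\ge 0\}$ be a centered (real-valued, càdlàg) Lévy process with finite moments of all orders. Let $\sigma^2$ be the variance of the Gaussian part of $X$, let $\nu$ be its Lévy measure, and let $m_k=\int_{\mathbb{R}} x^k\,\nu(dx)$ for $k\ge 2$. Define the polynomials $$Q_n(x,t)=\Gamma_n\big(x,\,-(m_2+\sigma^2)t,\,-m_3t,\,\ldots,\,-m_nt\big),\qquad n\ge1,$$ and $Q_0(x,t)=1$. Then: (a) $Q_n(x,t)$, $n\ge 1$, are time–space harmonic polynomials relative to $X$; (b) $Q_n(x,t)$, $n\ge1$, satisfy the recurrence relation $$Q_{n+1}(x,t)=xQ_n(x,t)-n(m_2+\sigma^2)\,t\,Q_{n-1}(x,t)-\sum_{j=2}^{n}\binom{n}{j}m_{j+1}\,t\,Q_{n-j}(x,t);$$ (c) writing $M_t^{(n)}=Q_n(X_t,t)$, an explicit expression for $M_t^{(n)}$ as a polynomial in $X_t$ is $$M_t^{(n)}=Q_n(X_t,t)=\sum_{j=0}^{n}\binom{n}{j}\Gamma_{n-j}\big(0,\,-(m_2+\sigma^2)t,\,-m_3t,\,\ldots,\,-m_{n-j}t\big)\,X_t^j,\qquad n\ge1;$$ (d) if $X$ is non-degenerate, then the family $\{Q_n(x,t),\ n\ge 0\}$ spans (as a real vector space) the set of all time–space harmonic polynomials relative to $X$.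
   Context: A Lévy process $X=\{X_t,\ t\ge0\}$ is a real-valued process with $X_0=0$, with stationary and independent increments, continuous in probability, and taken with càdlàg paths. Centered means $\mathbb{E}[X_t]=0$ for all $t$. Finite moments of all orders means $\mathbb{E}[|X_t|^p]<\infty$ for all $p\geq 1$ and $t\geq 0$; this implies that $\nu$ has moments of all orders $\ge 2$, so each $m_k$ ($k\ge 2$) is finite. Non-degenerate means that $X$ is not deterministic, i.e. $\sigma^2>0$ or $\nu\neq 0$. A time–space harmonic polynomial relative to $X$ is a (real) polynomial $Q(x,t)$ in two variables such that the process $M_t=Q(X_t,t)$, $t\ge0$, is a martingale with respect to the filtration associated with $X$. Polynomials $\Gamma_n$: $\Gamma_0=1$ and, for $n\ge 1$, $$\Gamma_n(x_1,\ldots,x_n)=n!\sum \frac{x_1^{r_1}}{(1!)^{r_1}r_1!}\cdots\frac{x_n^{r_n}}{(n!)^{r_n}r_n!},$$ where the sum is over all non-negative integers $r_1,\ldots,r_n$ such that $\sum_{j=1}^n j r_j=n$. Equivalently, as formal power series in $u$, $\exp\{\sum_{n\ge1}x_n u^n/n!\}=\sum_{n\ge0}\Gamma_n(x_1,\ldots,x_n)u^n/n!$. In expressions such as $\Gamma_k(y,-(m_2+\sigma^2)t,-m_3t,\ldots,-m_kt)$ only the first $k$ arguments are present, so for $k=1$ it is $\Gamma_1(y)=y$, for $k=2$ it is $\Gamma_2(y,-(m_2+\sigma^2)t)$, and for $k=0$ it is $1$. Empty sums are zero. *)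

theory Defs
  imports "HOL-Probability.Probability" "HOL-Library.Function_Algebras"
begin

definition cadlag :: "(real \<Rightarrow> real) \<Rightarrow> bool" where
  "cadlag f \<longleftrightarrow>
     (\<forall>t\<ge>0. continuous (at_right t) f) \<and> (\<forall>t>0. \<exists>l. (f \<longlongrightarrow> l) (at_left t))"

text \<open>The time set is \<open>[0,\<infinity>)\<close>; the values of \<open>X t\<close> for \<open>t < 0\<close> are irrelevant.
  As usual, \<open>X\<^sub>0 = 0\<close> and the path regularity are required almost surely.\<close>

locale levy_process = prob_space M for M :: "'a measure" +
  fixes X :: "real \<Rightarrow> 'a \<Rightarrow> real"
  assumes random_variable_X: "\<And>t. t \<ge> 0 \<Longrightarrow> random_variable borel (X t)"
    and X_zero: "AE \<omega> in M. X 0 \<omega> = 0"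
    and stationary_increments:
      "\<And>s t. 0 \<le> s \<Longrightarrow> s \<le> t \<Longrightarrow>
         distr M borel (\<lambda>\<omega>. X t \<omega> - X s \<omega>) = distr M borel (X (t - s))"
    and independent_increments:
      "\<And>(n::nat) \<tau>. 0 \<le> \<tau> 0 \<Longrightarrow> (\<And>i. i < n \<Longrightarrow> \<tau> i < \<tau> (Suc i)) \<Longrightarrow>
         indep_vars (\<lambda>_. borel) (\<lambda>i \<omega>. X (\<tau> (Suc i)) \<omega> - X (\<tau> i) \<omega>) {..<n}"
    and continuous_in_probability:
      "\<And>t \<epsilon>. t \<ge> 0 \<Longrightarrow> \<epsilon> > 0 \<Longrightarrow>
         ((\<lambda>s. prob {\<omega> \<in> space M. \<bar>X s \<omega> - X t \<omega>\<bar> > \<epsilon>}) \<longlongrightarrow> 0) (at t within {0..})"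
    and cadlag_paths: "AE \<omega> in M. cadlag (\<lambda>t. X t \<omega>)"

definition levy_measure :: "real measure \<Rightarrow> bool" where
  "levy_measure \<nu> \<longleftrightarrow>
     sets \<nu> = sets borel \<and> emeasure \<nu> {0} = 0 \<and> (\<integral>\<^sup>+x. ennreal (min 1 (x\<^sup>2)) \<partial>\<nu>) < \<infinity>"

text \<open>\<open>X\<close> has drift \<open>\<gamma>\<close>, Gaussian variance \<open>\<sigma>\<^sup>2\<close> and Levy measure \<open>\<nu>\<close>: the Levy-Khintchine formula,
  with truncation function \<open>x 1\<^bsub>\<bar>x\<bar> \<le> 1\<^esub>\<close>.  The triplet \<open>(\<gamma>, \<sigma>\<^sup>2, \<nu>)\<close> exists and is unique for
  every Levy process.\<close>

definition has_levy_triplet ::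
    "'a measure \<Rightarrow> (real \<Rightarrow> 'a \<Rightarrow> real) \<Rightarrow> real \<Rightarrow> real \<Rightarrow> real measure \<Rightarrow> bool" where
  "has_levy_triplet M X \<gamma> \<sigma> \<nu> \<longleftrightarrow> levy_measure \<nu> \<and>
     (\<forall>t\<ge>0. \<forall>u. char (distr M borel (X t)) u =
        exp (complex_of_real t *
          (\<i> * complex_of_real (\<gamma> * u) - complex_of_real (\<sigma>\<^sup>2 * u\<^sup>2 / 2) +
           (CLINT x|\<nu>. iexp (u * x) - 1 - \<i> * complex_of_real (u * x * indicator {-1..1} x)))))"

definition centered :: "'a measure \<Rightarrow> (real \<Rightarrow> 'a \<Rightarrow> real) \<Rightarrow> bool" where
  "centered M X \<longleftrightarrow> (\<forall>t\<ge>0. integral\<^sup>L M (X t) = 0)"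

definition finite_moments :: "'a measure \<Rightarrow> (real \<Rightarrow> 'a \<Rightarrow> real) \<Rightarrow> bool" where
  "finite_moments M X \<longleftrightarrow> (\<forall>p\<ge>1. \<forall>t\<ge>0. integrable M (\<lambda>\<omega>. \<bar>X t \<omega>\<bar> powr p))"

definition non_degenerate :: "real \<Rightarrow> real measure \<Rightarrow> bool" where
  "non_degenerate \<sigma> \<nu> \<longleftrightarrow> \<sigma>\<^sup>2 > 0 \<or> emeasure \<nu> UNIV \<noteq> 0"

definition natural_filtration ::
    "'a measure \<Rightarrow> (real \<Rightarrow> 'a \<Rightarrow> real) \<Rightarrow> real \<Rightarrow> 'a measure" where
  "natural_filtration M X t =
     sigma (space M) {X s -` A \<inter> space M | s A. 0 \<le> s \<and> s \<le> t \<and> A \<in> sets borel}"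

definition martingale ::
    "'a measure \<Rightarrow> (real \<Rightarrow> 'a measure) \<Rightarrow> (real \<Rightarrow> 'a \<Rightarrow> real) \<Rightarrow> bool" where
  "martingale M F Y \<longleftrightarrow>
     (\<forall>t\<ge>0. subalgebra M (F t)) \<and>
     (\<forall>s\<ge>0. \<forall>t\<ge>s. subalgebra (F t) (F s)) \<and>
     (\<forall>t\<ge>0. Y t \<in> borel_measurable (F t)) \<and>
     (\<forall>t\<ge>0. integrable M (Y t)) \<and>
     (\<forall>s\<ge>0. \<forall>t\<ge>s. AE \<omega> in M. real_cond_exp M (F s) (Y t) \<omega> = Y s \<omega>)"

text \<open>Real polynomials in \<open>(x,t)\<close> are identified with polynomial functions on \<open>\<real>\<^sup>2\<close>.\<close>

definition time_space_harmonic ::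
    "'a measure \<Rightarrow> (real \<Rightarrow> 'a \<Rightarrow> real) \<Rightarrow> (real \<Rightarrow> real \<Rightarrow> real) \<Rightarrow> bool" where
  "time_space_harmonic M X Q \<longleftrightarrow>
     real_polynomial_function (\<lambda>(x, t). Q x t) \<and>
     martingale M (natural_filtration M X) (\<lambda>t \<omega>. Q (X t \<omega>) t)"

text \<open>Only \<open>x 1, \<dots>, x n\<close> matter; the extensional function space makes the index set of exponent
  vectors \<open>(r\<^sub>1, \<dots>, r\<^sub>n)\<close> finite.\<close>

definition Gamma_poly :: "nat \<Rightarrow> (nat \<Rightarrow> real) \<Rightarrow> real" where
  "Gamma_poly n x = fact n *
     (\<Sum>r\<in>{r \<in> {1..n} \<rightarrow>\<^sub>E UNIV. (\<Sum>j=1..n. j * r j) = n}.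
        \<Prod>j=1..n. x j ^ r j / (fact j ^ r j * fact (r j)))"

lemma finite_Gamma_index:
  "finite {r \<in> {1..n} \<rightarrow>\<^sub>E (UNIV :: nat set). (\<Sum>j=1..n. j * r j) = n}"
proof (rule finite_subset)
  show "{r \<in> {1..n} \<rightarrow>\<^sub>E (UNIV :: nat set). (\<Sum>j=1..n. j * r j) = n} \<subseteq> {1..n} \<rightarrow>\<^sub>E {..n}"
  proof
    fix r :: "nat \<Rightarrow> nat"
    assume r: "r \<in> {r \<in> {1..n} \<rightarrow>\<^sub>E UNIV. (\<Sum>j=1..n. j * r j) = n}"
    have "r j \<le> n" if j: "j \<in> {1..n}" for j
    proof -
      have "r j \<le> j * r j" using j by simp
      also have "\<dots> \<le> (\<Sum>j=1..n. j * r j)" using j by (intro member_le_sum) auto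
      finally show ?thesis using r by simp
    qed
    with r show "r \<in> {1..n} \<rightarrow>\<^sub>E {..n}" by (auto simp: PiE_iff)
  qed
qed (simp add: finite_PiE)

lemma Gamma_poly_0: "Gamma_poly 0 x = 1"
  by (simp add: Gamma_poly_def)

text \<open>For \<open>k \<ge> 2\<close> the integral converges absolutely whenever \<open>X\<close> has moments of all orders, so no
  integrability assumption on \<open>\<nu>\<close> is needed.\<close>

definition levy_moment :: "real measure \<Rightarrow> nat \<Rightarrow> real" where
  "levy_moment \<nu> k = (LINT x|\<nu>. x ^ k)"

text \<open>The argument sequence \<open>(x, -(m\<^sub>2 + \<sigma>\<^sup>2) t, -m\<^sub>3 t, -m\<^sub>4 t, \<dots>)\<close>, indexed from 1.\<close>

definition ts_args :: "real \<Rightarrow> real measure \<Rightarrow> real \<Rightarrow> real \<Rightarrow> nat \<Rightarrow> real" where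
  "ts_args \<sigma> \<nu> x t k =
     (if k = 1 then x
      else if k = 2 then - (levy_moment \<nu> 2 + \<sigma>\<^sup>2) * t
      else - levy_moment \<nu> k * t)"

definition ts_poly :: "real \<Rightarrow> real measure \<Rightarrow> nat \<Rightarrow> real \<Rightarrow> real \<Rightarrow> real" where
  "ts_poly \<sigma> \<nu> n x t = Gamma_poly n (ts_args \<sigma> \<nu> x t)"

lemma ts_poly_0: "ts_poly \<sigma> \<nu> 0 x t = 1"
  by (simp add: ts_poly_def Gamma_poly_0)

definition scale_fun2 :: "real \<Rightarrow> (real \<Rightarrow> real \<Rightarrow> real) \<Rightarrow> real \<Rightarrow> real \<Rightarrow> real" where
  "scale_fun2 c f = (\<lambda>x t. c * f x t)"

interpretation fun2: vector_space scale_fun2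
  by unfold_locales (auto simp: scale_fun2_def fun_eq_iff algebra_simps)

end

theory Submission
  imports Defs
begin

text \<open>
  Put \<open>\<kappa>\<^sub>2 = m\<^sub>2 + \<sigma>\<^sup>2\<close> and \<open>\<kappa>\<^sub>k = m\<^sub>k\<close> for \<open>k \<ge> 3\<close>.  The exponential generating function of
  \<open>Q\<^sub>n(x, t)\<close> is the formal series \<open>exp (x u - t K(u))\<close> with \<open>K(u) = \<Sum>\<^sub>k \<kappa>\<^sub>k u^k / k!\<close>.  This gives
  the recurrence, the expansion in powers of \<open>x\<close>, and the addition formula
  \<open>Q\<^sub>n(x + y, s + t) = \<Sum>\<^sub>j (n choose j) Q\<^sub>j(x, s) Q\<^bsub>n-j\<^esub>(y, t)\<close>.

  The power series involved need not converge, so the Levy-Khintchine formula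
  \<open>E exp(i u X\<^sub>t) = exp (t \<psi>(u))\<close> is read as an identity of asymptotic expansions at \<open>u = 0\<close>.  It says
  that the moments of \<open>X\<^sub>t\<close> have exponential generating function \<open>exp (t K(u))\<close>, hence
  \<open>E Q\<^sub>n(X\<^sub>t, t) = 0\<close> for \<open>n \<ge> 1\<close>.  With the addition formula and the independence of \<open>X\<^sub>t - X\<^sub>s\<close> from
  the past, this is the martingale property.

  Every polynomial is \<open>\<Sum>\<^sub>j a\<^sub>j(t) Q\<^sub>j(x, t)\<close> with polynomials \<open>a\<^sub>j\<close>.  If it is time-space harmonic,
  then for \<open>s \<le> t\<close> conditioning on the past of \<open>s\<close> gives
  \<open>\<Sum>\<^sub>j (a\<^sub>j(t) - a\<^sub>j(s)) Q\<^sub>j(X\<^sub>s, s) = 0\<close> almost surely.  In the non-degenerate case no nonzero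
  polynomial vanishes almost surely at \<open>X\<^sub>s\<close> when \<open>s > 0\<close>, so the \<open>a\<^sub>j\<close> are constant.
\<close>

unbundle no vec_syntax
unbundle fps_syntax

section \<open>The polynomials \<open>\<Gamma>\<^sub>n\<close>\<close>

definition partition_vectors :: "nat \<Rightarrow> nat \<Rightarrow> (nat \<Rightarrow> nat) set" where
  "partition_vectors N n = {r \<in> {1..N} \<rightarrow>\<^sub>E UNIV. (\<Sum>j=1..N. j * r j) = n}"

definition partition_weight :: "nat \<Rightarrow> (nat \<Rightarrow> real) \<Rightarrow> (nat \<Rightarrow> nat) \<Rightarrow> real" where
  "partition_weight N x r = (\<Prod>j=1..N. x j ^ r j / (fact j ^ r j * fact (r j)))"

text \<open>The number \<open>N\<close> of variables is kept apart from the weight \<open>n\<close>: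
  removing a part lowers the weight but leaves the index range alone, so the recursion can be proved
  at a fixed \<open>N\<close>.\<close>

definition partition_sum :: "nat \<Rightarrow> nat \<Rightarrow> (nat \<Rightarrow> real) \<Rightarrow> real" where
  "partition_sum N n x = (\<Sum>r\<in>partition_vectors N n. partition_weight N x r)"

lemma partition_vectors_le:
  assumes "r \<in> partition_vectors N n" "j \<in> {1..N}"
  shows "j * r j \<le> n"
proof -
  have "j * r j \<le> (\<Sum>j=1..N. j * r j)" using assms(2) by (intro member_le_sum) auto
  then show ?thesis using assms by (simp add: partition_vectors_def)
qed

lemma finite_partition_vectors: "finite (partition_vectors N n)"
proof (rule finite_subset)
  show "partition_vectors N n \<subseteq> {1..N} \<rightarrow>\<^sub>E {..n}"
  proof
    fix r assume r: "r \<in> partition_vectors N n"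
    have "r j \<le> n" if "j \<in> {1..N}" for j
    proof -
      have "r j \<le> j * r j" using that by simp
      then show ?thesis using partition_vectors_le[OF r that] by linarith
    qed
    with r show "r \<in> {1..N} \<rightarrow>\<^sub>E {..n}" by (auto simp: PiE_iff partition_vectors_def)
  qed
qed (simp add: finite_PiE)

lemma Gamma_poly_partition_sum: "Gamma_poly n x = fact n * partition_sum n n x"
  by (simp add: Gamma_poly_def partition_sum_def partition_vectors_def partition_weight_def)

text \<open>A part of size \<open>Suc N\<close> exceeds the weight, so its exponent is 0 and its
  factor 1. The bijection trades this 0 for \<open>undefined\<close>, the value of an extensional
  vector outside its index range.\<close>

lemma partition_sum_Suc:
  assumes "n \<le> N"
  shows "partition_sum (Suc N) n x = partition_sum N n x"
  unfolding partition_sum_def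
proof (rule sum.reindex_bij_witness[where i = "\<lambda>r. r(Suc N := 0)" and j = "\<lambda>r. r(Suc N := undefined)"])
  fix r assume r: "r \<in> partition_vectors (Suc N) n"
  have "Suc N * r (Suc N) \<le> n" by (rule partition_vectors_le[OF r]) simp
  then have z: "r (Suc N) = 0" using assms by (cases "r (Suc N)") auto
  show "(r(Suc N := undefined))(Suc N := 0) = r" using z by auto
  show "r(Suc N := undefined) \<in> partition_vectors N n"
    using r z by (auto simp: partition_vectors_def PiE_iff extensional_def)
  show "partition_weight N x (r(Suc N := undefined)) = partition_weight (Suc N) x r"
    using z by (auto simp: partition_weight_def intro!: prod.cong)
next
  fix r assume r: "r \<in> partition_vectors N n"
  show "(r(Suc N := 0))(Suc N := undefined) = r"
    using r by (auto simp: partition_vectors_def PiE_iff extensional_def)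
  show "r(Suc N := 0) \<in> partition_vectors (Suc N) n"
    using r by (auto simp: partition_vectors_def PiE_iff extensional_def)
qed

lemma partition_sum_eq: "n \<le> N \<Longrightarrow> partition_sum N n x = partition_sum n n x"
  by (induction N rule: dec_induct) (auto simp: partition_sum_Suc)

text \<open>Removing one part of size \<open>j\<close> maps the vectors with \<open>0 < r j\<close>
  bijectively onto those of weight \<open>n - j\<close>, and the factor \<open>r j\<close> cancels
  against \<open>fact (r j)\<close>. This computes the Euler operator in the variable
  \<open>x j\<close>.\<close>

lemma sum_partition_weight_times:
  assumes j: "j \<in> {1..N}" "j \<le> n"
  shows "(\<Sum>r\<in>partition_vectors N n. real (r j) * partition_weight N x r) =
    x j / fact j * partition_sum N (n - j) x"
proof -
  have "(\<Sum>r\<in>partition_vectors N n. real (r j) * partition_weight N x r) =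
      (\<Sum>r\<in>{r \<in> partition_vectors N n. 0 < r j}. real (r j) * partition_weight N x r)"
    by (rule sum.mono_neutral_right) (auto simp: finite_partition_vectors)
  also have "\<dots> = (\<Sum>r\<in>partition_vectors N (n - j). x j / fact j * partition_weight N x r)"
  proof (rule sum.reindex_bij_witness[where i = "\<lambda>r. r(j := Suc (r j))" and j = "\<lambda>r. r(j := r j - 1)"])
    fix r assume r: "r \<in> {r \<in> partition_vectors N n. 0 < r j}"
    have split: "(\<Sum>i=1..N. i * r i) = j * r j + (\<Sum>i\<in>{1..N}-{j}. i * r i)" for r
      using j by (simp add: sum.remove)
    show "(r(j := r j - 1))(j := Suc ((r(j := r j - 1)) j)) = r" using r by auto
    have "j * r j = j + j * (r j - 1)" using r by (cases "r j") auto
    then have "j * (r j - 1) + (\<Sum>i\<in>{1..N}-{j}. i * r i) = n - j"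
      using r split[of r] by (auto simp: partition_vectors_def)
    then have "(\<Sum>i=1..N. i * (r(j := r j - 1)) i) = n - j"
      unfolding split[of "r(j := r j - 1)"] by simp
    then show "r(j := r j - 1) \<in> partition_vectors N (n - j)"
      using r j by (auto simp: partition_vectors_def PiE_iff extensional_def)
    obtain m where m: "r j = Suc m" using r by (cases "r j") auto
    have wsplit: "partition_weight N x r = x j ^ r j / (fact j ^ r j * fact (r j)) *
        (\<Prod>i\<in>{1..N}-{j}. x i ^ r i / (fact i ^ r i * fact (r i)))" for r
      unfolding partition_weight_def using j by (subst prod.remove[of _ j]) auto
    have "x j / fact j * (x j ^ m / (fact j ^ m * fact m)) =
        real (Suc m) * (x j ^ Suc m / (fact j ^ Suc m * fact (Suc m)))"
      by (simp add: field_simps del: of_nat_Suc)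
    then show "x j / fact j * partition_weight N x (r(j := r j - 1)) = real (r j) * partition_weight N x r"
      unfolding wsplit[of r] wsplit[of "r(j := r j - 1)"] using m by simp
  next
    fix r assume r: "r \<in> partition_vectors N (n - j)"
    show "(r(j := Suc (r j)))(j := (r(j := Suc (r j))) j - 1) = r" by auto
    have split: "(\<Sum>i=1..N. i * r i) = j * r j + (\<Sum>i\<in>{1..N}-{j}. i * r i)" for r
      using j by (simp add: sum.remove)
    have "(\<Sum>i=1..N. i * (r(j := Suc (r j))) i) = n"
      unfolding split[of "r(j := Suc (r j))"] using split[of r] r j
      by (auto simp: partition_vectors_def)
    then show "r(j := Suc (r j)) \<in> {r \<in> partition_vectors N n. 0 < r j}"
      using r j by (auto simp: partition_vectors_def PiE_iff extensional_def)
  qed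
  finally show ?thesis by (simp add: partition_sum_def sum_distrib_left)
qed

text \<open>Euler's identity for a weighted homogeneous polynomial: \<open>n\<close> is the sum of
  the \<open>j * r j\<close> for each vector, so the factor \<open>n\<close> can be distributed over
  the parts and the two sums exchanged.\<close>

lemma partition_sum_rec:
  assumes "n \<le> N"
  shows "real n * partition_sum N n x = (\<Sum>j=1..n. real j * (x j / fact j) * partition_sum N (n - j) x)"
proof -
  have "real n * partition_sum N n x =
      (\<Sum>r\<in>partition_vectors N n. \<Sum>j=1..N. real j * (real (r j) * partition_weight N x r))"
    unfolding partition_sum_def sum_distrib_left
  proof (rule sum.cong)
    fix r assume "r \<in> partition_vectors N n"
    then have "real n = (\<Sum>j=1..N. real j * real (r j))"
      by (auto simp: partition_vectors_def simp flip: of_nat_mult of_nat_sum)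
    then show "real n * partition_weight N x r = (\<Sum>j=1..N. real j * (real (r j) * partition_weight N x r))"
      by (simp add: sum_distrib_right mult.assoc)
  qed simp
  also have "\<dots> = (\<Sum>j=1..N. real j * (\<Sum>r\<in>partition_vectors N n. real (r j) * partition_weight N x r))"
    by (subst sum.swap) (simp add: sum_distrib_left)
  \<comment> \<open>A part larger than \<open>n\<close> cannot occur, so the sum stops at
    \<open>n\<close>.\<close>
  also have "\<dots> = (\<Sum>j=1..n. real j * (\<Sum>r\<in>partition_vectors N n. real (r j) * partition_weight N x r))"
  proof (rule sum.mono_neutral_right, goal_cases)
    case 3
    show ?case
    proof
      fix j assume j: "j \<in> {1..N} - {1..n}"
      have "r j = 0" if "r \<in> partition_vectors N n" for r
        using partition_vectors_le[OF that, of j] j by (cases "r j") auto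
      then have "(\<Sum>r\<in>partition_vectors N n. real (r j) * partition_weight N x r) = 0"
        by (intro sum.neutral) simp
      then show "real j * (\<Sum>r\<in>partition_vectors N n. real (r j) * partition_weight N x r) = 0" by simp
    qed
  qed (use assms in auto)
  also have "\<dots> = (\<Sum>j=1..n. real j * (x j / fact j) * partition_sum N (n - j) x)"
  proof (rule sum.cong)
    fix j assume "j \<in> {1..n}"
    then show "real j * (\<Sum>r\<in>partition_vectors N n. real (r j) * partition_weight N x r) =
        real j * (x j / fact j) * partition_sum N (n - j) x"
      using assms by (subst sum_partition_weight_times) auto
  qed simp
  finally show ?thesis .
qed

lemma Gamma_poly_rec:
  "Gamma_poly (Suc n) x = (\<Sum>j\<le>n. real (n choose j) * x (Suc j) * Gamma_poly (n - j) x)"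
proof -
  have "Gamma_poly (Suc n) x = fact n * (real (Suc n) * partition_sum (Suc n) (Suc n) x)"
    by (simp add: Gamma_poly_partition_sum)
  also have "\<dots> = fact n * (\<Sum>j=1..Suc n. real j * (x j / fact j) * partition_sum (Suc n) (Suc n - j) x)"
    by (subst partition_sum_rec) auto
  also have "\<dots> = (\<Sum>j\<le>n. fact n * (real (Suc j) * (x (Suc j) / fact (Suc j)) * partition_sum (Suc n) (n - j) x))"
    unfolding sum_distrib_left
    by (rule sum.reindex_bij_witness[where i = Suc and j = "\<lambda>j. j - 1"]) auto
  also have "\<dots> = (\<Sum>j\<le>n. real (n choose j) * x (Suc j) * Gamma_poly (n - j) x)"
  proof (rule sum.cong)
    fix j assume "j \<in> {..n}"
    then have j: "j \<le> n" by simp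
    have "real (Suc j) * (x (Suc j) / fact (Suc j)) = x (Suc j) / fact j"
      by (simp add: divide_simps del: of_nat_Suc)
    moreover have "partition_sum (Suc n) (n - j) x = Gamma_poly (n - j) x / fact (n - j)"
      by (simp add: Gamma_poly_partition_sum partition_sum_eq[of "n - j" "Suc n"])
    ultimately show "fact n * (real (Suc j) * (x (Suc j) / fact (Suc j)) * partition_sum (Suc n) (n - j) x) =
        real (n choose j) * x (Suc j) * Gamma_poly (n - j) x"
      by (simp only: binomial_fact[OF j]) simp
  qed simp
  finally show ?thesis .
qed

section \<open>Exponential generating functions\<close>

definition egf :: "(nat \<Rightarrow> 'a::field_char_0) \<Rightarrow> 'a fps" where
  "egf a = Abs_fps (\<lambda>n. a n / fact n)"

lemma egf_nth [simp]: "egf a $ n = a n / fact n"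
  by (simp add: egf_def)

lemma fps_deriv_egf: "fps_deriv (egf a) = egf (\<lambda>n. a (Suc n))"
  by (rule fps_ext) (simp add: field_simps del: of_nat_Suc)

lemma egf_mult_nth:
  "(egf a * egf b) $ n = (\<Sum>j\<le>n. of_nat (n choose j) * a j * b (n - j)) / fact n"
  unfolding fps_mult_nth sum_divide_distrib atLeast0AtMost
  by (rule sum.cong) (simp_all add: binomial_fact field_simps)

text \<open>The identity \<open>G = exp Y\<close> for the exponential generating functions \<open>G\<close> of \<open>\<Gamma>\<^sub>n(x)\<close> and \<open>Y\<close>
  of \<open>x\<close> appears as the differential equation \<open>G' = Y' G\<close> with \<open>G(0) = 1\<close>.\<close>

lemma fps_deriv_egf_Gamma_poly:
  "fps_deriv (egf (\<lambda>n. Gamma_poly n x)) = egf (\<lambda>n. x (Suc n)) * egf (\<lambda>n. Gamma_poly n x)"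
  by (rule fps_ext) (simp add: fps_deriv_egf Gamma_poly_rec egf_mult_nth)

text \<open>Comparing coefficients expresses \<open>H $ Suc n\<close> through earlier ones; the
  division by \<open>Suc n\<close> uses characteristic 0.\<close>

lemma fps_linear_ode_unique:
  fixes F G A :: "'a::field_char_0 fps"
  assumes "fps_deriv F = A * F" "fps_deriv G = A * G" "F $ 0 = G $ 0"
  shows "F = G"
proof (rule fps_ext)
  have rec: "H $ Suc n = (\<Sum>j\<le>n. A $ j * H $ (n - j)) / of_nat (Suc n)" if "fps_deriv H = A * H" for H n
  proof -
    have "of_nat (Suc n) * H $ Suc n = (\<Sum>j\<le>n. A $ j * H $ (n - j))"
      using arg_cong[OF that, of "\<lambda>f. f $ n"] by (simp add: fps_mult_nth atLeast0AtMost)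
    then show ?thesis by (simp add: field_simps del: of_nat_Suc)
  qed
  fix n show "F $ n = G $ n"
  proof (induction n rule: less_induct)
    case (less n)
    then show ?case using assms(3) by (cases n) (auto simp: rec[OF assms(1)] rec[OF assms(2)])
  qed
qed

text \<open>This is exp (Y + Z) = exp Y exp Z: by the product rule both sides solve the same linear
  differential equation with initial value 1.\<close>

lemma egf_Gamma_poly_add:
  "egf (\<lambda>n. Gamma_poly n (\<lambda>k. x k + y k)) = egf (\<lambda>n. Gamma_poly n x) * egf (\<lambda>n. Gamma_poly n y)"
proof (rule fps_linear_ode_unique[OF fps_deriv_egf_Gamma_poly])
  have "egf (\<lambda>n. x (Suc n) + y (Suc n)) = egf (\<lambda>n. x (Suc n)) + egf (\<lambda>n. y (Suc n))"
    by (rule fps_ext) (simp add: add_divide_distrib)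
  then show "fps_deriv (egf (\<lambda>n. Gamma_poly n x) * egf (\<lambda>n. Gamma_poly n y)) =
      egf (\<lambda>n. x (Suc n) + y (Suc n)) * (egf (\<lambda>n. Gamma_poly n x) * egf (\<lambda>n. Gamma_poly n y))"
    by (simp add: fps_deriv_egf_Gamma_poly algebra_simps)
qed (simp add: Gamma_poly_0)

lemma Gamma_poly_add:
  "Gamma_poly n (\<lambda>k. x k + y k) = (\<Sum>j\<le>n. real (n choose j) * Gamma_poly j x * Gamma_poly (n - j) y)"
  using arg_cong[OF egf_Gamma_poly_add[of x y], of "\<lambda>f. f $ n"] by (simp add: egf_mult_nth)

text \<open>Only \<open>j = 0\<close> survives in the recursion; the generating function is exp (x
  u).\<close>

lemma Gamma_poly_single: "Gamma_poly n (\<lambda>k. if k = 1 then x else 0) = x ^ n"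
proof (induction n)
  case (Suc n)
  have "Gamma_poly (Suc n) (\<lambda>k. if k = 1 then x else 0) =
     (\<Sum>j\<in>{0}. real (n choose j) * x * Gamma_poly (n - j) (\<lambda>k. if k = 1 then x else 0))"
    unfolding Gamma_poly_rec by (rule sum.mono_neutral_cong_right) auto
  then show ?case using Suc by simp
qed (simp add: Gamma_poly_0)

section \<open>Algebra of the time-space polynomials\<close>

text \<open>Each argument is linear in \<open>(x, t)\<close>; through \<open>Gamma_poly_add\<close>
  this becomes the addition formula behind the martingale property.\<close>

lemma ts_args_add: "ts_args \<sigma> \<nu> (x + y) (s + t) = (\<lambda>k. ts_args \<sigma> \<nu> x s k + ts_args \<sigma> \<nu> y t k)"
  by (auto simp: ts_args_def algebra_simps)

lemma ts_poly_add:
  "ts_poly \<sigma> \<nu> n (x + y) (s + t) =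
     (\<Sum>j\<le>n. real (n choose j) * ts_poly \<sigma> \<nu> j x s * ts_poly \<sigma> \<nu> (n - j) y t)"
  by (simp add: ts_poly_def ts_args_add Gamma_poly_add)

text \<open>The factor exp (x u) splits off from the generating function at \<open>x = 0\<close>,
  which carries the dependence on \<open>t\<close>.\<close>

lemma ts_poly_explicit:
  "ts_poly \<sigma> \<nu> n x t =
     (\<Sum>j=0..n. real (n choose j) * Gamma_poly (n - j) (ts_args \<sigma> \<nu> 0 t) * x ^ j)"
proof -
  have "ts_args \<sigma> \<nu> x t = (\<lambda>k. (if k = 1 then x else 0) + ts_args \<sigma> \<nu> 0 t k)"
    by (auto simp: ts_args_def)
  then show ?thesis
    by (simp add: ts_poly_def Gamma_poly_add Gamma_poly_single[unfolded One_nat_def] atLeast0AtMost mult_ac)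
qed

text \<open>The cumulants of \<open>X 1\<close> for a centered process, whence 0 at
  \<open>k = 1\<close>; the Gaussian variance enters only at \<open>k = 2\<close>. With them the
  recurrence treats all its terms alike.\<close>

definition cumulant :: "real \<Rightarrow> real measure \<Rightarrow> nat \<Rightarrow> real" where
  "cumulant \<sigma> \<nu> k = (if k < 2 then 0 else if k = 2 then \<sigma>\<^sup>2 + levy_moment \<nu> 2 else levy_moment \<nu> k)"

lemma ts_poly_Suc:
  "ts_poly \<sigma> \<nu> (Suc n) x t = x * ts_poly \<sigma> \<nu> n x t
     - t * (\<Sum>j\<le>n. real (n choose j) * cumulant \<sigma> \<nu> (Suc j) * ts_poly \<sigma> \<nu> (n - j) x t)"
proof -
  have "ts_args \<sigma> \<nu> x t (Suc j) = (if j = 0 then x else 0) - t * cumulant \<sigma> \<nu> (Suc j)" for j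
    by (auto simp: ts_args_def cumulant_def algebra_simps)
  then have "ts_poly \<sigma> \<nu> (Suc n) x t = (\<Sum>j\<le>n. (if j = 0 then x * ts_poly \<sigma> \<nu> n x t else 0)
      - t * (real (n choose j) * cumulant \<sigma> \<nu> (Suc j) * ts_poly \<sigma> \<nu> (n - j) x t))"
    unfolding ts_poly_def Gamma_poly_rec by (intro sum.cong) (auto simp: left_diff_distrib right_diff_distrib mult_ac)
  then show ?thesis by (simp add: sum_subtractf sum_distrib_left)
qed

lemma ts_poly_recurrence:
  "ts_poly \<sigma> \<nu> (n + 1) x t = x * ts_poly \<sigma> \<nu> n x t
     - real n * (levy_moment \<nu> 2 + \<sigma>\<^sup>2) * t * ts_poly \<sigma> \<nu> (n - 1) x t
     - (\<Sum>j=2..n. real (n choose j) * levy_moment \<nu> (j + 1) * t * ts_poly \<sigma> \<nu> (n - j) x t)"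
proof -
  let ?f = "\<lambda>j. real (n choose j) * cumulant \<sigma> \<nu> (Suc j) * ts_poly \<sigma> \<nu> (n - j) x t"
  have "(\<Sum>j\<le>n. ?f j) = real n * (levy_moment \<nu> 2 + \<sigma>\<^sup>2) * ts_poly \<sigma> \<nu> (n - 1) x t + (\<Sum>j=2..n. ?f j)"
  \<comment> \<open>At \<open>n = 0\<close> the truncated \<open>n - 1\<close> is 0, and the factor
    \<open>real n\<close> removes the term.\<close>
  proof (cases "n = 0")
    case False
    then have "{..n} = insert 0 (insert 1 {2..n})" by auto
    then show ?thesis by (simp add: cumulant_def eval_nat_numeral)
  qed (simp add: cumulant_def)
  moreover have "t * (\<Sum>j=2..n. ?f j) =
      (\<Sum>j=2..n. real (n choose j) * levy_moment \<nu> (j + 1) * t * ts_poly \<sigma> \<nu> (n - j) x t)"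
    unfolding sum_distrib_left by (rule sum.cong) (auto simp: cumulant_def)
  ultimately show ?thesis by (simp add: ts_poly_Suc algebra_simps)
qed

section \<open>Asymptotic expansions at \<open>0\<close>\<close>

text \<open>\<open>has_taylor f F\<close>: the formal power series \<open>F\<close>, which need not converge, is the asymptotic
  expansion of \<open>f\<close> at \<open>0\<close>.  The filter \<open>nhds 0\<close>, in place of \<open>at 0\<close>, forces \<open>f 0 = F $ 0\<close>.\<close>

definition has_taylor :: "(real \<Rightarrow> complex) \<Rightarrow> complex fps \<Rightarrow> bool" where
  "has_taylor f F \<longleftrightarrow>
     (\<forall>n. (\<lambda>u. f u - (\<Sum>k<n. F $ k * of_real u ^ k)) \<in> O[nhds 0](\<lambda>u. of_real u ^ n))"

lemma has_taylorD:
  "has_taylor f F \<Longrightarrow> (\<lambda>u. f u - (\<Sum>k<n. F $ k * of_real u ^ k)) \<in> O[nhds 0](\<lambda>u. of_real u ^ n)"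
  by (simp add: has_taylor_def)

lemma power_bigo_nhds_0:
  assumes "n \<le> k"
  shows "(\<lambda>u. complex_of_real u ^ k) \<in> O[nhds 0](\<lambda>u. of_real u ^ n)"
proof (rule bigoI[where c = 1])
  have "eventually (\<lambda>u::real. u \<in> ball 0 1) (nhds 0)"
    by (intro eventually_nhds_in_open) auto
  then show "\<forall>\<^sub>F u in nhds 0. norm (complex_of_real u ^ k) \<le> 1 * norm (complex_of_real u ^ n)"
    by eventually_elim (use assms in \<open>auto simp: norm_power intro!: power_decreasing\<close>)
qed

lemma tendsto_bigo_1:
  fixes f :: "'a::topological_space \<Rightarrow> 'b::real_normed_field"
  assumes "(f \<longlongrightarrow> l) F"
  shows "f \<in> O[F](\<lambda>_. 1)"
proof (rule bigoI[where c = "norm l + 1"])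
  have "((\<lambda>x. norm (f x)) \<longlongrightarrow> norm l) F" by (rule tendsto_norm[OF assms])
  then have "eventually (\<lambda>x. norm (f x) < norm l + 1) F" by (rule order_tendstoD) simp
  then show "\<forall>\<^sub>F x in F. norm (f x) \<le> (norm l + 1) * norm (1::'b)"
    by eventually_elim simp
qed

text \<open>Expansions of arbitrarily high order suffice: the extra terms between degrees
  \<open>n\<close> and \<open>m\<close> are themselves O(u^n).\<close>

lemma has_taylorI:
  assumes "\<And>n. \<exists>m\<ge>n. (\<lambda>u. f u - (\<Sum>k<m. F $ k * of_real u ^ k)) \<in> O[nhds 0](\<lambda>u. of_real u ^ m)"
  shows "has_taylor f F"
  unfolding has_taylor_def
proof
  fix n
  obtain m where m: "m \<ge> n"
    and *: "(\<lambda>u. f u - (\<Sum>k<m. F $ k * of_real u ^ k)) \<in> O[nhds 0](\<lambda>u. of_real u ^ m)"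
    using assms by blast
  have "(\<lambda>u. f u - (\<Sum>k<m. F $ k * of_real u ^ k)) \<in> O[nhds 0](\<lambda>u. of_real u ^ n)"
    using landau_o.big.trans[OF * power_bigo_nhds_0[OF m]] .
  moreover have "(\<lambda>u. \<Sum>k=n..<m. F $ k * of_real u ^ k) \<in> O[nhds 0](\<lambda>u. of_real u ^ n)"
  proof (rule big_sum_in_bigo)
    fix k assume "k \<in> {n..<m}"
    then have "(\<lambda>u. complex_of_real u ^ k) \<in> O[nhds 0](\<lambda>u. of_real u ^ n)"
      by (intro power_bigo_nhds_0) simp
    then show "(\<lambda>u. F $ k * complex_of_real u ^ k) \<in> O[nhds 0](\<lambda>u. of_real u ^ n)"
      by (cases "F $ k = 0") auto
  qed
  ultimately have "(\<lambda>u. (f u - (\<Sum>k<m. F $ k * of_real u ^ k)) + (\<Sum>k=n..<m. F $ k * of_real u ^ k))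
      \<in> O[nhds 0](\<lambda>u. of_real u ^ n)"
    by (rule sum_in_bigo)
  moreover have "(\<Sum>k<m. F $ k * of_real u ^ k) =
      (\<Sum>k<n. F $ k * of_real u ^ k) + (\<Sum>k=n..<m. F $ k * of_real u ^ k)" for u
    using sum.atLeastLessThan_concat[of 0 n m "\<lambda>k. F $ k * of_real u ^ k"] m by (simp add: lessThan_atLeast0)
  ultimately show "(\<lambda>u. f u - (\<Sum>k<n. F $ k * of_real u ^ k)) \<in> O[nhds 0](\<lambda>u. of_real u ^ n)"
    by (simp add: algebra_simps)
qed

text \<open>At the first degree \<open>n\<close> where the series differ, subtracting the two
  remainders shows that c u^n is O(u^(n+1)), which forces \<open>c = 0\<close>.\<close>

lemma has_taylor_unique:
  assumes F: "has_taylor f F" and G: "has_taylor f G"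
  shows "F = G"
proof (rule ccontr)
  assume "F \<noteq> G"
  define n where "n = subdegree (F - G)"
  define c where "c = (F - G) $ n"
  have c: "c \<noteq> 0" using \<open>F \<noteq> G\<close> nth_subdegree_nonzero[of "F - G"] unfolding c_def n_def by simp
  have "(\<lambda>u. (f u - (\<Sum>k<Suc n. G $ k * of_real u ^ k)) - (f u - (\<Sum>k<Suc n. F $ k * of_real u ^ k)))
      \<in> O[nhds 0](\<lambda>u. of_real u ^ Suc n)"
    by (intro sum_in_bigo has_taylorD F G)
  moreover have "(f u - (\<Sum>k<Suc n. G $ k * of_real u ^ k)) - (f u - (\<Sum>k<Suc n. F $ k * of_real u ^ k))
      = c * of_real u ^ n" for u
  proof -
    have "F $ k = G $ k" if "k < n" for k
      using nth_less_subdegree_zero[of k "F - G"] that by (simp add: n_def)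
    then show ?thesis by (simp add: c_def algebra_simps)
  qed
  ultimately have "(\<lambda>u. c * of_real u ^ n) \<in> O[nhds 0](\<lambda>u. of_real u ^ Suc n)" by simp
  then obtain C where "\<forall>\<^sub>F u in nhds 0. norm (c * of_real u ^ n) \<le> C * norm (complex_of_real u ^ Suc n)"
    by (rule landau_o.bigE)
  \<comment> \<open>The punctured neighbourhood permits division by \<open>u ^ n\<close>.\<close>
  then have "\<forall>\<^sub>F u in at (0::real). norm (c * of_real u ^ n) \<le> C * norm (complex_of_real u ^ Suc n)"
    by (auto simp: eventually_at_filter elim: eventually_mono)
  moreover have "\<forall>\<^sub>F u in at (0::real). u \<noteq> 0" by (simp add: eventually_at_filter)
  ultimately have "\<forall>\<^sub>F u in at (0::real). norm c \<le> C * \<bar>u\<bar>"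
  proof eventually_elim
    case (elim u)
    then have "norm c * \<bar>u\<bar> ^ n \<le> (C * \<bar>u\<bar>) * \<bar>u\<bar> ^ n" by (simp add: norm_mult norm_power algebra_simps)
    then show ?case using elim(2) by simp
  qed
  moreover have "((\<lambda>u. C * \<bar>u\<bar>) \<longlongrightarrow> 0) (at (0::real))"
    by (rule tendsto_eq_intros | simp)+
  ultimately have "norm c \<le> 0"
    by (intro tendsto_le[OF _ _ tendsto_const]) auto
  with c show False by simp
qed

lemma has_taylor_const: "has_taylor (\<lambda>_. c) (fps_const c)"
proof (rule has_taylorI, rule exI, rule conjI)
  fix n :: nat
  show "n \<le> Suc n" by simp
  have "(\<Sum>k<Suc n. fps_const c $ k * of_real u ^ k) = c" for u
    by (subst sum.mono_neutral_right[of _ "{0}"]) auto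
  then show "(\<lambda>u. c - (\<Sum>k<Suc n. fps_const c $ k * of_real u ^ k)) \<in> O[nhds 0](\<lambda>u. of_real u ^ Suc n)"
    by simp
qed

lemma has_taylor_X: "has_taylor of_real fps_X"
proof (rule has_taylorI, rule exI, rule conjI)
  fix n :: nat
  show "n \<le> Suc (Suc n)" by simp
  have "(\<Sum>k<Suc (Suc n). fps_X $ k * of_real u ^ k) = complex_of_real u" for u
    by (subst sum.mono_neutral_right[of _ "{1}"]) auto
  then show "(\<lambda>u. of_real u - (\<Sum>k<Suc (Suc n). fps_X $ k * of_real u ^ k)) \<in> O[nhds 0](\<lambda>u. complex_of_real u ^ Suc (Suc n))"
    by simp
qed

lemma has_taylor_add:
  assumes "has_taylor f F" "has_taylor g G"
  shows "has_taylor (\<lambda>u. f u + g u) (F + G)"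
  unfolding has_taylor_def
proof
  fix n
  have "(\<lambda>u. (f u - (\<Sum>k<n. F $ k * of_real u ^ k)) + (g u - (\<Sum>k<n. G $ k * of_real u ^ k)))
      \<in> O[nhds 0](\<lambda>u. of_real u ^ n)"
    by (intro sum_in_bigo has_taylorD assms)
  then show "(\<lambda>u. f u + g u - (\<Sum>k<n. (F + G) $ k * of_real u ^ k)) \<in> O[nhds 0](\<lambda>u. of_real u ^ n)"
    by (simp add: algebra_simps sum.distrib)
qed

lemma has_taylor_bigo_1:
  assumes "has_taylor f F"
  shows "f \<in> O[nhds 0](\<lambda>_. 1)"
  using has_taylorD[OF assms, of 0] by simp

text \<open>Replacing the factors one at a time by their truncations costs O(u^n), as the other
  factor is bounded. The product of the truncations differs from the truncated product by finitely
  many terms of degree at least \<open>n\<close>, indexed by \<open>?B\<close>.\<close>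

lemma has_taylor_mult:
  assumes "has_taylor f F" "has_taylor g G"
  shows "has_taylor (\<lambda>u. f u * g u) (F * G)"
  unfolding has_taylor_def
proof
  fix n
  let ?p = "\<lambda>u. \<Sum>k<n. F $ k * complex_of_real u ^ k" and ?q = "\<lambda>u. \<Sum>k<n. G $ k * complex_of_real u ^ k"
  let ?B = "{ij \<in> {..<n} \<times> {..<n}. n \<le> fst ij + snd ij}"
  let ?t = "\<lambda>u (i, j). F $ i * G $ j * complex_of_real u ^ (i + j)"
  have eq: "f u * g u - (\<Sum>k<n. (F * G) $ k * of_real u ^ k) =
      (f u - ?p u) * g u + ?p u * (g u - ?q u) + (\<Sum>ij\<in>?B. ?t u ij)" for u
  proof -
    have "?p u * ?q u = (\<Sum>ij\<in>{..<n} \<times> {..<n}. ?t u ij)"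
      unfolding sum_product sum.cartesian_product by (rule sum.cong) (auto simp: power_add)
    also have "{..<n} \<times> {..<n} = {ij. fst ij + snd ij < n} \<union> ?B" by auto
    also have "(\<Sum>ij\<in>\<dots>. ?t u ij) = (\<Sum>ij\<in>{ij. fst ij + snd ij < n}. ?t u ij) + (\<Sum>ij\<in>?B. ?t u ij)"
    proof (rule sum.union_disjoint)
      show "finite {ij. fst ij + snd ij < n}"
        by (rule finite_subset[of _ "{..<n} \<times> {..<n}"]) auto
      show "finite ?B" by (rule finite_subset[of _ "{..<n} \<times> {..<n}"]) auto
    qed auto
    also have "(\<Sum>ij\<in>{ij. fst ij + snd ij < n}. ?t u ij) = (\<Sum>(k, i)\<in>(SIGMA k:{..<n}. {..k}). ?t u (i, k - i))"
      by (rule sum.reindex_bij_witness[where i = "\<lambda>(k, i). (i, k - i)" and j = "\<lambda>(i, j). (i + j, i)"]) auto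
    also have "\<dots> = (\<Sum>k<n. \<Sum>i\<le>k. ?t u (i, k - i))"
      by (subst sum.Sigma) auto
    also have "\<dots> = (\<Sum>k<n. (F * G) $ k * of_real u ^ k)"
      by (intro sum.cong) (auto simp: fps_mult_nth sum_distrib_right atLeast0AtMost)
    finally have "?p u * ?q u = (\<Sum>k<n. (F * G) $ k * of_real u ^ k) + (\<Sum>ij\<in>?B. ?t u ij)" .
    moreover have "a * b - s = (a - p) * b + p * (b - q) + t" if "p * q = s + t" for a b s p q t :: complex
      using that by (simp add: algebra_simps)
    ultimately show ?thesis by blast
  qed
  have p: "?p \<in> O[nhds 0](\<lambda>_. 1)"
    by (rule tendsto_bigo_1[where l = "?p 0"]) (auto intro!: tendsto_eq_intros filterlim_ident)
  have "(\<lambda>u. (f u - ?p u) * g u + ?p u * (g u - ?q u) + (\<Sum>ij\<in>?B. ?t u ij)) \<in> O[nhds 0](\<lambda>u. of_real u ^ n)"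
  proof (intro sum_in_bigo big_sum_in_bigo)
    show "(\<lambda>u. (f u - ?p u) * g u) \<in> O[nhds 0](\<lambda>u. of_real u ^ n)"
      using landau_o.big.mult[OF has_taylorD[OF assms(1), of n] has_taylor_bigo_1[OF assms(2)]] by simp
    show "(\<lambda>u. ?p u * (g u - ?q u)) \<in> O[nhds 0](\<lambda>u. of_real u ^ n)"
      using landau_o.big.mult[OF p has_taylorD[OF assms(2), of n]] by simp
    fix ij assume "ij \<in> ?B"
    then have "(\<lambda>u. complex_of_real u ^ (fst ij + snd ij)) \<in> O[nhds 0](\<lambda>u. of_real u ^ n)"
      by (intro power_bigo_nhds_0) simp
    then show "(\<lambda>u. ?t u ij) \<in> O[nhds 0](\<lambda>u. of_real u ^ n)"
      by (cases ij; cases "F $ fst ij * G $ snd ij = 0") auto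
  qed
  then show "(\<lambda>u. f u * g u - (\<Sum>k<n. (F * G) $ k * of_real u ^ k)) \<in> O[nhds 0](\<lambda>u. of_real u ^ n)"
    by (simp only: eq)
qed

lemma has_taylor_cmult: "has_taylor f F \<Longrightarrow> has_taylor (\<lambda>u. c * f u) (fps_const c * F)"
  by (rule has_taylor_mult[OF has_taylor_const])

lemma has_taylor_diff:
  assumes "has_taylor f F" "has_taylor g G"
  shows "has_taylor (\<lambda>u. f u - g u) (F - G)"
proof -
  have "fps_const (- 1) * G = - G" by (simp add: fps_eq_iff)
  with has_taylor_add[OF assms(1) has_taylor_cmult[OF assms(2), of "- 1"]] show ?thesis by simp
qed

lemma has_taylor_power: "has_taylor f F \<Longrightarrow> has_taylor (\<lambda>u. f u ^ n) (F ^ n)"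
  using has_taylor_const[of 1] by (induction n) (auto intro: has_taylor_mult)

lemma has_taylor_sum:
  "(\<And>i. i \<in> I \<Longrightarrow> has_taylor (f i) (F i)) \<Longrightarrow> has_taylor (\<lambda>u. \<Sum>i\<in>I. f i u) (\<Sum>i\<in>I. F i)"
  using has_taylor_const[of 0] by (induction I rule: infinite_finite_induct) (auto intro: has_taylor_add)

lemma has_taylor_scale:
  assumes "has_taylor f F"
  shows "has_taylor (\<lambda>u. f (a * u)) (Abs_fps (\<lambda>n. F $ n * of_real a ^ n))"
  unfolding has_taylor_def
proof
  fix n
  have lim: "filterlim (\<lambda>u. a * u) (nhds 0) (nhds (0::real))"
    by (rule tendsto_eq_intros filterlim_ident | simp)+
  have "(\<lambda>u. f (a * u) - (\<Sum>k<n. F $ k * of_real (a * u) ^ k)) \<in> O[nhds 0](\<lambda>u. of_real (a * u) ^ n)"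
    using landau_o.big.compose[OF has_taylorD[OF assms, of n] lim] .
  also have "(\<lambda>u. complex_of_real (a * u) ^ n) \<in> O[nhds 0](\<lambda>u. of_real u ^ n)"
    by (simp add: power_mult_distrib)
  finally show "(\<lambda>u. f (a * u) - (\<Sum>k<n. Abs_fps (\<lambda>n. F $ n * of_real a ^ n) $ k * of_real u ^ k))
      \<in> O[nhds 0](\<lambda>u. of_real u ^ n)"
    by (simp add: power_mult_distrib mult.assoc)
qed

text \<open>The remainder is \<open>z ^ n\<close> times the shifted series, which is continuous at 0
  and therefore bounded nearby.\<close>

lemma has_fps_expansion_bigo:
  fixes h :: "complex \<Rightarrow> complex"
  assumes "h has_fps_expansion H"
  shows "(\<lambda>z. h z - (\<Sum>k<n. H $ k * z ^ k)) \<in> O[nhds 0](\<lambda>z. z ^ n)"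
proof -
  define r where "r = eval_fps (fps_shift n H)"
  have pos: "fps_conv_radius H > 0" and ev: "\<forall>\<^sub>F z in nhds 0. eval_fps H z = h z"
    using assms by (auto simp: has_fps_expansion_def)
  have "\<forall>\<^sub>F z in nhds 0. z \<in> eball 0 (fps_conv_radius H)"
    using pos by (intro eventually_nhds_in_open) (auto simp: zero_ereal_def)
  with ev have eq: "\<forall>\<^sub>F z in nhds 0. h z - (\<Sum>k<n. H $ k * z ^ k) = r z * z ^ n"
  proof eventually_elim
    case (elim z)
    then have sm: "summable (\<lambda>k. H $ k * z ^ k)" by (intro summable_fps) simp
    have "h z = (\<Sum>k. H $ (k + n) * z ^ (k + n)) + (\<Sum>k<n. H $ k * z ^ k)"
      using suminf_split_initial_segment[OF sm, of n] elim(1) by (simp add: eval_fps_def)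
    also have "(\<Sum>k. H $ (k + n) * z ^ (k + n)) = (\<Sum>k. (H $ (k + n) * z ^ k) * z ^ n)"
      by (simp add: power_add mult_ac)
    also have "\<dots> = r z * z ^ n"
      unfolding r_def eval_fps_def fps_shift_nth
      by (rule suminf_mult2[symmetric]) (use elim(2) summable_fps[of z "fps_shift n H"] in simp)
    finally show ?case by simp
  qed
  have "isCont r 0" unfolding r_def using pos by (intro continuous_eval_fps) (auto simp: zero_ereal_def)
  then have "(r \<longlongrightarrow> r 0) (nhds 0)" by (simp add: isCont_def tendsto_at_iff_tendsto_nhds)
  then have "r \<in> O[nhds 0](\<lambda>_. 1)" by (rule tendsto_bigo_1)
  then have "(\<lambda>z. r z * z ^ n) \<in> O[nhds 0](\<lambda>z. 1 * z ^ n)"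
    by (intro landau_o.big.mult) auto
  then show ?thesis using landau_o.big.in_cong[OF eq] by simp
qed

text \<open>The outer function is analytic, the inner one has only an asymptotic expansion. Since
  \<open>F $ 0 = 0\<close> gives f = O(u), cutting the outer series at \<open>n\<close> costs
  O(u^n). What remains is a polynomial in \<open>f\<close>, covered by sums and products; powers
  \<open>F ^ k\<close> with \<open>k \<ge> n\<close> do not reach degrees below
  \<open>n\<close>.\<close>

lemma has_taylor_compose:
  assumes h: "h has_fps_expansion H" and f: "has_taylor f F" and "F $ 0 = 0"
  shows "has_taylor (\<lambda>u. h (f u)) (H oo F)"
  unfolding has_taylor_def
proof
  fix n
  have fu: "f \<in> O[nhds 0](\<lambda>u. of_real u)"
    using has_taylorD[OF f, of 1] assms(3) by simp
  have "f \<in> o[nhds 0](\<lambda>_. 1)"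
  proof (rule landau_o.big_small_trans[OF fu])
    show "complex_of_real \<in> o[nhds 0](\<lambda>_. 1)"
      by (rule smalloI_tendsto) (auto intro!: tendsto_eq_intros filterlim_ident)
  qed
  then have "filterlim f (nhds 0) (nhds 0)" by (auto dest: smalloD_tendsto)
  then have "(\<lambda>u. h (f u) - (\<Sum>k<n. H $ k * f u ^ k)) \<in> O[nhds 0](\<lambda>u. f u ^ n)"
    by (rule landau_o.big.compose[OF has_fps_expansion_bigo[OF h]])
  also have "(\<lambda>u. f u ^ n) \<in> O[nhds 0](\<lambda>u. of_real u ^ n)"
    using fu by (rule landau_o.big_power)
  finally have 1: "(\<lambda>u. h (f u) - (\<Sum>k<n. H $ k * f u ^ k)) \<in> O[nhds 0](\<lambda>u. of_real u ^ n)" .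
  let ?T = "\<Sum>k<n. fps_const (H $ k) * F ^ k"
  have T: "has_taylor (\<lambda>u. \<Sum>k<n. H $ k * f u ^ k) ?T"
    by (intro has_taylor_sum has_taylor_cmult has_taylor_power f)
  have "?T $ i = (H oo F) $ i" if "i < n" for i
    unfolding fps_compose_nth fps_sum_nth
    by (rule sum.mono_neutral_cong_right) (use that assms(3) in \<open>auto simp: startsby_zero_power_prefix\<close>)
  then have 2: "(\<lambda>u. (\<Sum>k<n. H $ k * f u ^ k) - (\<Sum>k<n. (H oo F) $ k * of_real u ^ k)) \<in> O[nhds 0](\<lambda>u. of_real u ^ n)"
    using has_taylorD[OF T, of n] by simp
  from sum_in_bigo(1)[OF 1 2]
  show "(\<lambda>u. h (f u) - (\<Sum>k<n. (H oo F) $ k * of_real u ^ k)) \<in> O[nhds 0](\<lambda>u. of_real u ^ n)"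
    by simp
qed

section \<open>Moments of the Levy measure\<close>

text \<open>As \<open>u\<close> is real, conjugation acts on the coefficients alone. This serves to
  expand the squared modulus of a characteristic function.\<close>

lemma has_taylor_cnj:
  assumes "has_taylor f F"
  shows "has_taylor (\<lambda>u. cnj (f u)) (Abs_fps (\<lambda>n. cnj (F $ n)))"
  unfolding has_taylor_def
proof
  fix n
  have "cnj (f u) - (\<Sum>k<n. Abs_fps (\<lambda>n. cnj (F $ n)) $ k * of_real u ^ k) =
      cnj (f u - (\<Sum>k<n. F $ k * of_real u ^ k))" for u
    by simp
  then show "(\<lambda>u. cnj (f u) - (\<Sum>k<n. Abs_fps (\<lambda>n. cnj (F $ n)) $ k * of_real u ^ k))
      \<in> O[nhds 0](\<lambda>u. of_real u ^ n)"
    using has_taylorD[OF assms, of n] by (simp only: bigo_def complex_mod_cnj mem_Collect_eq)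
qed

lemma has_taylor_char:
  fixes M :: "'a measure" and X :: "'a \<Rightarrow> real"
  assumes "prob_space M" "X \<in> borel_measurable M" "\<And>k. integrable M (\<lambda>\<omega>. X \<omega> ^ k)"
  shows "has_taylor (char (distr M borel X)) (egf (\<lambda>k. \<i> ^ k * of_real (integral\<^sup>L M (\<lambda>\<omega>. X \<omega> ^ k))))"
    (is "has_taylor ?f ?F")
  unfolding has_taylor_def
proof
  fix n
  \<comment> \<open>The error bound at order \<open>n\<close> keeps the term of degree
    \<open>n\<close> in the sum; that term is O(u^n) and is then moved into the error.\<close>
  have "norm (?f u - (\<Sum>k\<le>n. ?F $ k * of_real u ^ k)) \<le>
      2 * integral\<^sup>L M (\<lambda>\<omega>. \<bar>X \<omega>\<bar> ^ n) / fact n * norm (complex_of_real u ^ n)" for u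
    using prob_space.char_approx1'[OF assms(1), of n X "distr M borel X" u] assms(2,3)
    by (simp add: norm_power power_mult_distrib field_simps)
  then have "(\<lambda>u. ?f u - (\<Sum>k\<le>n. ?F $ k * of_real u ^ k)) \<in> O[nhds 0](\<lambda>u. of_real u ^ n)"
    by (intro bigoI always_eventually allI)
  moreover have "(\<lambda>u. ?F $ n * of_real u ^ n) \<in> O[nhds 0](\<lambda>u. of_real u ^ n)"
    by (cases "?F $ n = 0") simp_all
  ultimately have "(\<lambda>u. (?f u - (\<Sum>k\<le>n. ?F $ k * of_real u ^ k)) + ?F $ n * of_real u ^ n)
      \<in> O[nhds 0](\<lambda>u. of_real u ^ n)"
    by (rule sum_in_bigo)
  then show "(\<lambda>u. ?f u - (\<Sum>k<n. ?F $ k * of_real u ^ k)) \<in> O[nhds 0](\<lambda>u. of_real u ^ n)"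
    by (simp add: lessThan_Suc_atMost[symmetric])
qed

section \<open>Central differences and powers of 2 - 2 cos\<close>

text \<open>An \<open>n\<close>-th finite difference kills polynomials of degree below
  \<open>n\<close>. Up to \<open>fact m\<close>, the sum is the coefficient of u^m in (exp u - 1)^n
  exp (-a u), a series starting at u^n.\<close>

lemma alternating_binomial_sum_power:
  fixes a :: "'a::field_char_0"
  assumes "m < n"
  shows "(\<Sum>j\<le>n. (- 1) ^ (n - j) * of_nat (n choose j) * (of_nat j - a) ^ m) = 0"
proof -
  let ?E = "fps_exp 1 :: 'a fps"
  have "(?E - 1) $ 0 = 0" by simp
  then have "((?E - 1) ^ n * fps_exp (- a)) $ m = 0"
    unfolding fps_mult_nth using assms by (intro sum.neutral) (auto simp: startsby_zero_power_prefix)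
  moreover have "(?E - 1) ^ n * fps_exp (- a) =
      (\<Sum>j\<le>n. fps_const ((- 1) ^ (n - j) * of_nat (n choose j)) * fps_exp (of_nat j - a))"
  proof -
    have "(?E - 1) ^ n = (\<Sum>j\<le>n. of_nat (n choose j) * ?E ^ j * (- 1) ^ (n - j))"
      using binomial_ring[of ?E "- 1" n] by simp
    moreover have "of_nat (n choose j) * ?E ^ j * (- 1) ^ (n - j) * fps_exp (- a) =
        fps_const ((- 1) ^ (n - j) * of_nat (n choose j)) * fps_exp (of_nat j - a)" for j
    proof -
      have "?E ^ j * fps_exp (- a) = fps_exp (of_nat j - a)"
        by (simp add: fps_exp_power_mult fps_exp_add_mult[symmetric])
      moreover have "of_nat (n choose j) * (- 1) ^ (n - j) = fps_const ((- 1) ^ (n - j) * of_nat (n choose j) :: 'a)"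
      proof -
        have "fps_const (- 1) = (- 1 :: 'a fps)" by (metis fps_const_neg fps_const_1_eq_1)
        then show ?thesis
          by (simp only: fps_const_mult[symmetric] fps_const_power[symmetric] fps_of_nat mult.commute)
      qed
      ultimately show ?thesis by (metis (no_types, lifting) mult.assoc mult.commute)
    qed
    ultimately show ?thesis by (simp add: sum_distrib_right)
  qed
  ultimately have "(\<Sum>j\<le>n. (- 1) ^ (n - j) * of_nat (n choose j) * ((of_nat j - a) ^ m / fact m)) = 0"
    by (simp add: fps_sum_nth)
  then have "(\<Sum>j\<le>n. (- 1) ^ (n - j) * of_nat (n choose j) * (of_nat j - a) ^ m) / fact m = 0"
    by (simp add: sum_divide_distrib)
  then show ?thesis by simp
qed

text \<open>Signed coefficients of the central difference of order \<open>2 * k\<close>, from (2 - 2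
  cos y)^k = (-1)^k (exp (i y/2) - exp (-i y/2))^(2k). The outer minus sign comes from expanding in
  1 - cos instead of cos.\<close>

definition cos_power_coeff :: "nat \<Rightarrow> nat \<Rightarrow> real" where
  "cos_power_coeff k j = - ((- 1) ^ (k + j) * real ((2 * k) choose j))"

lemma cos_power_coeff_moment:
  assumes "m < 2 * k"
  shows "(\<Sum>j\<le>2*k. cos_power_coeff k j * (real j - real k) ^ m) = 0"
proof -
  have "(\<Sum>j\<le>2*k. cos_power_coeff k j * (real j - real k) ^ m) =
      - ((- 1) ^ k) * (\<Sum>j\<le>2*k. (- 1) ^ (2 * k - j) * real ((2 * k) choose j) * (real j - real k) ^ m)"
    unfolding sum_distrib_left
    by (rule sum.cong) (auto simp: cos_power_coeff_def minus_one_power_iff)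
  then show ?thesis using alternating_binomial_sum_power[OF assms, of "real k"] by simp
qed

text \<open>With w = exp (i y) one has (w - 1)^2 = w (2 cos y - 2); raise to the power
  \<open>k\<close>, expand binomially, divide by w^k and take real parts. The form with 1 - cos is
  chosen because 1 - cos (u x), unlike the cosine, is integrable against every Levy measure.\<close>

lemma power_2_minus_2_cos:
  assumes "k > 0"
  shows "(2 - 2 * cos y) ^ k = (\<Sum>j\<le>2*k. cos_power_coeff k j * (1 - cos ((real j - real k) * y)))"
proof -
  let ?w = "cis y"
  have w: "?w \<noteq> 0" by simp
  have "(?w - 1)\<^sup>2 = ?w * of_real (2 * cos y - 2)"
  proof -
    have "?w * of_real (2 * cos y - 2) = ?w * (?w + cis (- y) - 2)"
      by (simp add: complex_eq_iff cis.ctr)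
    also have "\<dots> = (?w - 1)\<^sup>2"
      by (simp add: power2_eq_square algebra_simps cis_mult)
    finally show ?thesis ..
  qed
  then have "(?w - 1) ^ (2 * k) = ?w ^ k * of_real ((2 * cos y - 2) ^ k)"
    by (simp add: power_mult power_mult_distrib)
  moreover have "(?w - 1) ^ (2 * k) = (\<Sum>j\<le>2*k. of_nat ((2 * k) choose j) * ?w ^ j * (- 1) ^ (2 * k - j))"
    using binomial_ring[of ?w "- 1" "2 * k"] by simp
  ultimately have "of_real ((2 * cos y - 2) ^ k) =
      (\<Sum>j\<le>2*k. of_nat ((2 * k) choose j) * ?w ^ j * (- 1) ^ (2 * k - j)) / ?w ^ k"
    using w by (simp add: field_simps)
  also have "\<dots> = (\<Sum>j\<le>2*k. of_real ((- 1) ^ j * real ((2 * k) choose j)) * cis ((real j - real k) * y))"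
    unfolding sum_divide_distrib
  proof (rule sum.cong)
    fix j assume "j \<in> {..2 * k}"
    then have s: "(- 1) ^ (2 * k - j) = ((- 1) ^ j :: complex)" by (auto simp: minus_one_power_iff)
    have w: "?w ^ j / ?w ^ k = cis ((real j - real k) * y)"
      by (simp only: Complex.DeMoivre cis_divide left_diff_distrib)
    then show "of_nat ((2 * k) choose j) * ?w ^ j * (- 1) ^ (2 * k - j) / ?w ^ k =
        of_real ((- 1) ^ j * real ((2 * k) choose j)) * cis ((real j - real k) * y)"
    proof -
      have "of_nat ((2 * k) choose j) * ?w ^ j * (- 1) ^ (2 * k - j) / ?w ^ k =
          of_nat ((2 * k) choose j) * (- 1) ^ (2 * k - j) * (?w ^ j / ?w ^ k)" by simp
      then show ?thesis unfolding w s by simp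
    qed
  qed simp
  finally have "(2 * cos y - 2) ^ k = Re (\<Sum>j\<le>2*k. of_real ((- 1) ^ j * real ((2 * k) choose j)) * cis ((real j - real k) * y))"
    by (metis Re_complex_of_real)
  also have "\<dots> = (\<Sum>j\<le>2*k. (- 1) ^ j * real ((2 * k) choose j) * cos ((real j - real k) * y))"
    by (simp add: Re_sum)
  finally have c: "(2 * cos y - 2) ^ k = (\<Sum>j\<le>2*k. (- 1) ^ j * real ((2 * k) choose j) * cos ((real j - real k) * y))" .
  \<comment> \<open>The constants introduced by passing to 1 - cos add up to this alternating sum,
    which vanishes for \<open>k > 0\<close>.\<close>
  have z: "(\<Sum>j\<le>2*k. (- 1) ^ j * real ((2 * k) choose j)) = 0"
    using choose_alternating_sum[of "2 * k"] assms by (simp add: atLeast0AtMost)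
  have "(2 - 2 * cos y) ^ k = (- 1) ^ k * (2 * cos y - 2) ^ k"
    by (simp flip: power_mult_distrib)
  also have "\<dots> = (\<Sum>j\<le>2*k. cos_power_coeff k j * (1 - cos ((real j - real k) * y)))
       + (- 1) ^ k * (\<Sum>j\<le>2*k. (- 1) ^ j * real ((2 * k) choose j))"
    unfolding c sum_distrib_left sum.distrib[symmetric]
    by (rule sum.cong) (auto simp: cos_power_coeff_def power_add algebra_simps)
  finally show ?thesis using z by simp
qed

section \<open>Integrability of the Levy-Khintchine kernel\<close>

lemma integrable_min_1_power2:
  assumes "levy_measure \<nu>"
  shows "integrable \<nu> (\<lambda>x. min 1 (x\<^sup>2))"
proof (rule integrableI_nonneg)
  show "(\<lambda>x. min 1 (x\<^sup>2)) \<in> borel_measurable \<nu>"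
    using assms by (simp add: levy_measure_def cong: measurable_cong_sets)
qed (use assms in \<open>auto simp: levy_measure_def\<close>)

text \<open>For |x| at most 1 the kernel is the second-order remainder of the exponential, at most
  u^2 x^2 / 2; for larger jumps the compensator vanishes and the bound 2 is enough. The constant
  covers both cases.\<close>

lemma norm_levy_kernel_le:
  "norm (iexp (u * x) - 1 - \<i> * complex_of_real (u * x * indicator {-1..1} x)) \<le> (2 + u\<^sup>2) * min 1 (x\<^sup>2)"
proof (cases "\<bar>x\<bar> \<le> 1")
  case True
  have x2: "x\<^sup>2 \<le> 1" using True by (simp add: abs_square_le_1)
  have "norm (iexp (u * x) - (\<Sum>k\<le>1. (\<i> * (u * x)) ^ k / fact k)) \<le> \<bar>u * x\<bar>\<^sup>2 / 2"
    using iexp_approx1[of "u * x" 1] by (simp add: eval_nat_numeral)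
  also have "\<dots> \<le> (2 + u\<^sup>2) * x\<^sup>2"
    by (simp add: power_mult_distrib distrib_right)
  finally show ?thesis using True x2
    by (simp add: indicator_def abs_le_iff min_absorb2 diff_diff_eq)
next
  case False
  then have "1 \<le> x\<^sup>2" using abs_square_le_1[of x] by linarith
  have "norm (iexp (u * x) - 1) \<le> norm (iexp (u * x)) + norm (1 :: complex)" by (rule norm_triangle_ineq4)
  then have "norm (iexp (u * x) - 1) \<le> 2" by simp
  also have "\<dots> \<le> (2 + u\<^sup>2) * min 1 (x\<^sup>2)" using \<open>1 \<le> x\<^sup>2\<close> by simp
  finally show ?thesis using False by (auto simp: indicator_def abs_le_iff)
qed

lemma integrable_levy_kernel:
  assumes "levy_measure \<nu>"
  shows "integrable \<nu> (\<lambda>x. iexp (u * x) - 1 - \<i> * complex_of_real (u * x * indicator {-1..1} x))"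
proof (rule Bochner_Integration.integrable_bound)
  show "integrable \<nu> (\<lambda>x. (2 + u\<^sup>2) * min 1 (x\<^sup>2))"
    by (intro integrable_mult_right integrable_min_1_power2 assms)
  show "(\<lambda>x. iexp (u * x) - 1 - \<i> * complex_of_real (u * x * indicator {-1..1} x)) \<in> borel_measurable \<nu>"
    using assms by (simp add: levy_measure_def cong: measurable_cong_sets)
  show "AE x in \<nu>. norm (iexp (u * x) - 1 - \<i> * complex_of_real (u * x * indicator {-1..1} x))
      \<le> norm ((2 + u\<^sup>2) * min 1 (x\<^sup>2))"
    using norm_levy_kernel_le[of u] by (intro always_eventually) (simp add: abs_mult)
qed

lemma integrable_1_minus_cos:
  assumes "levy_measure \<nu>"
  shows "integrable \<nu> (\<lambda>x. 1 - cos (u * x))"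
proof -
  have "integrable \<nu> (\<lambda>x. cos (u * x) - 1)"
    using integrable_Re[OF integrable_levy_kernel[OF assms, of u]] by (simp add: Re_exp)
  from integrable_minus[OF this] show ?thesis by simp
qed

text \<open>The \<open>k\<close>-th power of \<open>2 - 2 cos(u x)\<close> is a combination of dilates of \<open>1 - cos(u x)\<close> that
  annihilates all terms \<open>u^m\<close> with \<open>m < 2 k\<close>.  So its \<open>\<nu>\<close>-integral is \<open>O(u^(2 k))\<close> as \<open>u\<close> tends to \<open>0\<close>,
  and Fatou's lemma bounds the moment of order \<open>2 k\<close>.\<close>

lemma integrable_even_power:
  assumes nu: "levy_measure \<nu>" and k: "k > 0"
    and G: "has_taylor (\<lambda>u. complex_of_real (LINT x|\<nu>. 1 - cos (u * x))) G"
  shows "integrable \<nu> (\<lambda>x. x ^ (2 * k))"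
proof -
  have [measurable_cong]: "sets \<nu> = sets borel" using nu by (simp add: levy_measure_def)
  define S where "S u = (LINT x|\<nu>. (2 - 2 * cos (u * x)) ^ k)" for u
  have int: "integrable \<nu> (\<lambda>x. (2 - 2 * cos (u * x)) ^ k)" for u
    unfolding power_2_minus_2_cos[OF k] mult.assoc[symmetric]
    by (rule Bochner_Integration.integrable_sum, rule integrable_mult_right, rule integrable_1_minus_cos[OF nu])
  have S: "S u = (\<Sum>j\<le>2*k. cos_power_coeff k j * (LINT x|\<nu>. 1 - cos ((real j - real k) * u * x)))" for u
  proof -
    have "S u = (\<Sum>j\<le>2*k. LINT x|\<nu>. cos_power_coeff k j * (1 - cos ((real j - real k) * u * x)))"
      unfolding S_def power_2_minus_2_cos[OF k] mult.assoc[symmetric]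
      by (rule Bochner_Integration.integral_sum)
        (rule integrable_mult_right, rule integrable_1_minus_cos[OF nu])
    then show ?thesis by (simp only: integral_mult_right_zero)
  qed
  define F where "F = (\<Sum>j\<le>2*k. fps_const (complex_of_real (cos_power_coeff k j)) *
      Abs_fps (\<lambda>n. G $ n * of_real (real j - real k) ^ n))"
  have F: "has_taylor (\<lambda>u. complex_of_real (S u)) F"
    unfolding S of_real_sum of_real_mult F_def
    by (rule has_taylor_sum, rule has_taylor_cmult, rule has_taylor_scale[OF G])
  have "(\<lambda>u. complex_of_real (S u)) \<in> O[nhds 0](\<lambda>u. of_real u ^ (2 * k))"
  proof -
    have z: "F $ m = 0" if "m < 2 * k" for m
    proof -
      have "F $ m = G $ m * of_real (\<Sum>j\<le>2*k. cos_power_coeff k j * (real j - real k) ^ m)"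
        unfolding F_def fps_sum_nth of_real_sum sum_distrib_left by (rule sum.cong) auto
      then show ?thesis unfolding cos_power_coeff_moment[OF that] by simp
    qed
    have "(\<Sum>m<2 * k. F $ m * complex_of_real u ^ m) = 0" for u
      by (rule sum.neutral) (simp add: z)
    then show ?thesis using has_taylorD[OF F, of "2 * k"] by simp
  qed
  then obtain C where "\<forall>\<^sub>F u in nhds 0. norm (complex_of_real (S u)) \<le> C * norm (complex_of_real u ^ (2 * k))"
    by (rule landau_o.bigE)
  then have ev: "\<forall>\<^sub>F u in nhds 0. \<bar>S u\<bar> \<le> C * u ^ (2 * k)"
    by (simp add: norm_power power_even_abs)
  \<comment> \<open>Fatou's lemma is applied along the sequence u = 1/(n+1), to the integrand of
    S(u) / u^(2k).\<close>
  define h where "h n x = (2 - 2 * cos (inverse (real (Suc n)) * x)) ^ k / inverse (real (Suc n)) ^ (2 * k)" for n x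
  have hm [measurable]: "h n \<in> borel_measurable \<nu>" for n unfolding h_def by measurable
  have h0: "0 \<le> h n x" for n x unfolding h_def by (intro divide_nonneg_nonneg zero_le_power) auto
  have lim: "(\<lambda>n. h n x) \<longlonglongrightarrow> x ^ (2 * k)" for x
  proof -
    \<comment> \<open>The quotient is the square of 2 sin (u x / 2) / u, a difference quotient at 0
      with limit x.\<close>
    have "((\<lambda>u::real. (2 - 2 * cos (u * x)) / u\<^sup>2) \<longlongrightarrow> x\<^sup>2) (at 0)"
    proof -
      have "2 - 2 * cos (u * x) = (2 * sin (u * x / 2))\<^sup>2" for u
        using cos_double_sin[of "u * x / 2"] by (simp add: power_mult_distrib)
      then have eq: "(2 - 2 * cos (u * x)) / u\<^sup>2 = (2 * sin (u * x / 2) / u)\<^sup>2" for u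
        by (simp add: power_divide)
      have "((\<lambda>u. 2 * sin (u * x / 2)) has_real_derivative x) (at 0)"
        by (auto intro!: derivative_eq_intros)
      then have "((\<lambda>u. 2 * sin (u * x / 2) / u) \<longlongrightarrow> x) (at 0)"
        by (simp add: has_field_derivative_iff)
      then show ?thesis unfolding eq by (intro tendsto_power)
    qed
    moreover have "filterlim (\<lambda>n. inverse (real (Suc n))) (at 0) sequentially"
      using LIMSEQ_inverse_real_of_nat unfolding filterlim_at by simp
    ultimately have "(\<lambda>n. (2 - 2 * cos (inverse (real (Suc n)) * x)) / (inverse (real (Suc n)))\<^sup>2) \<longlonglongrightarrow> x\<^sup>2"
      by (rule filterlim_compose)
    from tendsto_power[OF this, of k] show ?thesis
      by (simp add: h_def power_divide power_mult)
  qed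
  have "(\<integral>\<^sup>+x. ennreal (x ^ (2 * k)) \<partial>\<nu>) = (\<integral>\<^sup>+x. liminf (\<lambda>n. ennreal (h n x)) \<partial>\<nu>)"
    by (intro nn_integral_cong lim_imp_Liminf[symmetric] tendsto_ennrealI lim) simp
  also have "\<dots> \<le> liminf (\<lambda>n. \<integral>\<^sup>+x. ennreal (h n x) \<partial>\<nu>)"
    by (rule nn_integral_liminf) simp
  also have "\<dots> \<le> liminf (\<lambda>n. ennreal C)"
  proof (rule Liminf_mono)
    have "filterlim (\<lambda>n. inverse (real (Suc n))) (nhds 0) sequentially"
      using LIMSEQ_inverse_real_of_nat .
    from eventually_compose_filterlim[OF ev this]
    show "\<forall>\<^sub>F n in sequentially. (\<integral>\<^sup>+x. ennreal (h n x) \<partial>\<nu>) \<le> ennreal C"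
    proof eventually_elim
      case (elim n)
      let ?u = "inverse (real (Suc n))"
      have "(\<integral>\<^sup>+x. ennreal (h n x) \<partial>\<nu>) = ennreal (LINT x|\<nu>. h n x)"
        using int h0 by (intro nn_integral_eq_integral) (auto simp: h_def)
      also have "(LINT x|\<nu>. h n x) = S ?u / ?u ^ (2 * k)"
        unfolding h_def S_def by simp
      also have "\<dots> \<le> C"
        using elim by (simp add: divide_le_eq del: of_nat_Suc)
      finally show ?case by (simp add: ennreal_leI)
    qed
  qed
  also have "\<dots> < \<infinity>" by (simp add: Liminf_const)
  finally show ?thesis by (intro integrableI_nonneg) (auto simp: power_mult)
qed

text \<open>For |x| at most 1 the power is dominated by x^2, otherwise by x^(2n).\<close>

lemma integrable_power_of_even:
  assumes nu: "levy_measure \<nu>" and even: "\<And>k. k > 0 \<Longrightarrow> integrable \<nu> (\<lambda>x. x ^ (2 * k))" and n: "2 \<le> n"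
  shows "integrable \<nu> (\<lambda>x. x ^ n)"
proof (rule Bochner_Integration.integrable_bound)
  show "integrable \<nu> (\<lambda>x. x ^ (2 * 1) + x ^ (2 * n))"
    using n by (intro Bochner_Integration.integrable_add even) auto
  show "(\<lambda>x. x ^ n) \<in> borel_measurable \<nu>"
    using nu by (simp add: levy_measure_def cong: measurable_cong_sets)
  have "\<bar>x ^ n\<bar> \<le> \<bar>x ^ (2 * 1) + x ^ (2 * n)\<bar>" for x :: real
  proof -
    have "\<bar>x\<bar> ^ n \<le> \<bar>x\<bar> ^ 2 + \<bar>x\<bar> ^ (2 * n)"
    proof (cases "\<bar>x\<bar> \<le> 1")
      case True
      then have "\<bar>x\<bar> ^ n \<le> \<bar>x\<bar> ^ 2" using n by (intro power_decreasing) auto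
      then show ?thesis by (smt (verit) zero_le_power abs_ge_zero)
    next
      case False
      then have "\<bar>x\<bar> ^ n \<le> \<bar>x\<bar> ^ (2 * n)" by (intro power_increasing) auto
      then show ?thesis by (smt (verit) zero_le_power abs_ge_zero)
    qed
    then show ?thesis by (simp add: power_abs power_mult)
  qed
  then show "AE x in \<nu>. norm (x ^ n) \<le> norm (x ^ (2 * 1) + x ^ (2 * n))" by simp
qed

section \<open>Expansion of the Levy exponent\<close>

definition levy_exponent :: "real \<Rightarrow> real \<Rightarrow> real measure \<Rightarrow> real \<Rightarrow> complex" where
  "levy_exponent \<gamma> \<sigma> \<nu> u =
     \<i> * complex_of_real (\<gamma> * u) - complex_of_real (\<sigma>\<^sup>2 * u\<^sup>2 / 2) +
       (CLINT x|\<nu>. iexp (u * x) - 1 - \<i> * complex_of_real (u * x * indicator {-1..1} x))"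

lemma Re_levy_exponent:
  assumes "levy_measure \<nu>"
  shows "Re (levy_exponent \<gamma> \<sigma> \<nu> u) = - (\<sigma>\<^sup>2 * u\<^sup>2 / 2) - (LINT x|\<nu>. 1 - cos (u * x))"
proof -
  have "Re (CLINT x|\<nu>. iexp (u * x) - 1 - \<i> * complex_of_real (u * x * indicator {-1..1} x)) =
      (LINT x|\<nu>. Re (iexp (u * x) - 1 - \<i> * complex_of_real (u * x * indicator {-1..1} x)))"
    by (rule integral_Re[symmetric, OF integrable_levy_kernel[OF assms]])
  also have "\<dots> = (LINT x|\<nu>. - (1 - cos (u * x)))"
    by (rule Bochner_Integration.integral_cong) (auto simp: Re_exp)
  also have "\<dots> = - (LINT x|\<nu>. 1 - cos (u * x))"
    by (rule integral_minus)
  finally show ?thesis by (simp add: levy_exponent_def)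
qed

text \<open>The coefficient formula is right at \<open>n = 0\<close> too, because division by zero
  yields 0 and Ln 1 = 0.\<close>

lemma has_fps_expansion_Ln_1_plus:
  "(\<lambda>z. Ln (1 + z)) has_fps_expansion Abs_fps (\<lambda>n. - ((- 1) ^ n) / of_nat n)"
proof (rule has_fps_expansionI)
  have "eventually (\<lambda>z::complex. z \<in> ball 0 1) (nhds 0)"
    by (intro eventually_nhds_in_open) auto
  then show "\<forall>\<^sub>F u in nhds 0. (\<lambda>n. Abs_fps (\<lambda>n. - ((- 1) ^ n) / of_nat n) $ n * u ^ n) sums Ln (1 + u)"
  proof eventually_elim
    case (elim z)
    then have "(\<lambda>n. - ((- z) ^ n) / of_nat n) sums Ln (1 + z)"
      by (intro Ln_series') simp
    moreover have "- ((- z) ^ n) / of_nat n = Abs_fps (\<lambda>n. - ((- 1) ^ n) / of_nat n) $ n * z ^ n" for n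
      by (simp add: power_minus[of z n])
    ultimately show ?case by (simp only:)
  qed
qed

text \<open>The real part of the exponent is the logarithm of the modulus of the characteristic
  function; so it inherits an asymptotic expansion from the moments of \<open>X\<close>
  before anything is known about the moments of \<open>\<nu>\<close>.\<close>

lemma has_taylor_integral_1_minus_cos:
  assumes nu: "levy_measure \<nu>"
    and \<phi>: "has_taylor (\<lambda>u. exp (levy_exponent \<gamma> \<sigma> \<nu> u)) A"
  obtains G where "has_taylor (\<lambda>u. complex_of_real (LINT x|\<nu>. 1 - cos (u * x))) G"
proof -
  let ?\<psi> = "levy_exponent \<gamma> \<sigma> \<nu>"
  let ?B = "A * Abs_fps (\<lambda>n. cnj (A $ n)) - fps_const 1"
  have "has_taylor (\<lambda>u. exp (?\<psi> u) * cnj (exp (?\<psi> u)) - 1) ?B"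
    by (intro has_taylor_diff has_taylor_mult has_taylor_cnj has_taylor_const \<phi>)
  \<comment> \<open>Composition with Ln (1 + z) requires an inner series without constant term; the
    value at \<open>u = 0\<close> can be read off since the filter is \<open>nhds 0\<close>.\<close>
  moreover have "?B $ 0 = 0"
  proof -
    have "exp (?\<psi> 0) = 1" by (simp add: levy_exponent_def)
    moreover have "A $ 0 = exp (?\<psi> 0)"
    proof -
      obtain c where "\<forall>\<^sub>F u in nhds 0. norm (exp (?\<psi> u) - A $ 0) \<le> c * norm (complex_of_real u)"
        using has_taylorD[OF \<phi>, of 1] by (auto elim!: landau_o.bigE)
      from eventually_nhds_x_imp_x[OF this] show ?thesis by simp
    qed
    ultimately show ?thesis by simp
  qed
  ultimately have "has_taylor (\<lambda>u. Ln (1 + (exp (?\<psi> u) * cnj (exp (?\<psi> u)) - 1)))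
      (Abs_fps (\<lambda>n. - ((- 1) ^ n) / of_nat n) oo ?B)"
    by (rule has_taylor_compose[OF has_fps_expansion_Ln_1_plus])
  \<comment> \<open>The squared modulus is a positive real, so the principal branch of
    \<open>Ln\<close> returns the real exponent.\<close>
  moreover have "Ln (1 + (exp (?\<psi> u) * cnj (exp (?\<psi> u)) - 1)) = of_real (2 * Re (?\<psi> u))" for u
  proof -
    have "exp (?\<psi> u) * cnj (exp (?\<psi> u)) = exp (of_real (2 * Re (?\<psi> u)))"
      by (simp add: exp_cnj complex_add_cnj flip: exp_add)
    then show ?thesis by (simp add: Ln_exp)
  qed
  ultimately have "has_taylor (\<lambda>u. of_real (2 * Re (?\<psi> u))) (Abs_fps (\<lambda>n. - ((- 1) ^ n) / of_nat n) oo ?B)"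
    by simp
  then have "has_taylor (\<lambda>u. of_real (- \<sigma>\<^sup>2 / 2) * (of_real u * of_real u) - of_real (1 / 2) * of_real (2 * Re (?\<psi> u)))
      (fps_const (of_real (- \<sigma>\<^sup>2 / 2)) * (fps_X * fps_X) -
       fps_const (of_real (1 / 2)) * (Abs_fps (\<lambda>n. - ((- 1) ^ n) / of_nat n) oo ?B))"
    by (intro has_taylor_diff has_taylor_cmult has_taylor_mult has_taylor_X)
  moreover have "of_real (- \<sigma>\<^sup>2 / 2) * (of_real u * of_real u) - of_real (1 / 2) * of_real (2 * Re (?\<psi> u)) =
      complex_of_real (LINT x|\<nu>. 1 - cos (u * x))" for u
    unfolding of_real_mult[symmetric] of_real_diff[symmetric] of_real_eq_iff Re_levy_exponent[OF nu]
    by (simp add: field_simps power2_eq_square)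
  ultimately show ?thesis using that by simp
qed

text \<open>With moments of all orders, the exponent expands into the cumulants of \<open>X\<^sub>1\<close>; the first
  one involves the jumps removed by the truncation.\<close>

definition exponent_cumulant :: "real \<Rightarrow> real \<Rightarrow> real measure \<Rightarrow> nat \<Rightarrow> real" where
  "exponent_cumulant \<gamma> \<sigma> \<nu> k =
     (if k = 0 then 0 else if k = 1 then \<gamma> + (LINT x|\<nu>. x * indicator (- {-1..1}) x) else cumulant \<sigma> \<nu> k)"

text \<open>The Taylor polynomial of exp (i u x) is subtracted under the integral. Its terms of
  degree at least 2 integrate to the moments of \<open>\<nu>\<close>; in degree 1 the compensator
  leaves only the jumps outside [-1, 1]. The remainder is at most |u x|^m / m!, so its integral is
  O(u^m).\<close>

lemma has_taylor_levy_exponent: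
  assumes nu: "levy_measure \<nu>" and int: "\<And>n. 2 \<le> n \<Longrightarrow> integrable \<nu> (\<lambda>x. x ^ n)"
  shows "has_taylor (levy_exponent \<gamma> \<sigma> \<nu>) (egf (\<lambda>k. \<i> ^ k * of_real (exponent_cumulant \<gamma> \<sigma> \<nu> k)))"
    (is "has_taylor ?\<psi> ?F")
proof (rule has_taylorI, rule exI, rule conjI)
  fix n :: nat
  \<comment> \<open>The offset 3 puts the degrees 0, 1 and 2, hence drift and Gaussian term, inside
    the sum.\<close>
  let ?m = "n + 3"
  let ?I = "\<lambda>x::real. x * indicator (- {-1..1}) x"
  let ?K = "\<lambda>u x. iexp (u * x) - 1 - \<i> * complex_of_real (u * x * indicator {-1..1} x)"
  let ?R = "\<lambda>u x. iexp (u * x) - (\<Sum>k<?m. (\<i> * complex_of_real (u * x)) ^ k / fact k)"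
  show "n \<le> ?m" by simp
  have [measurable_cong]: "sets \<nu> = sets borel" using nu by (simp add: levy_measure_def)
  have intI: "integrable \<nu> ?I"
  proof (rule Bochner_Integration.integrable_bound[OF int[OF order_refl]])
    have "\<bar>?I x\<bar> \<le> \<bar>x\<^sup>2\<bar>" for x
    proof (cases "x \<in> {-1..1}")
      case False
      then have "1 \<le> \<bar>x\<bar>" by auto
      then have "\<bar>x\<bar> * 1 \<le> \<bar>x\<bar> * \<bar>x\<bar>" by (intro mult_left_mono) auto
      then show ?thesis using False by (simp add: power2_eq_square abs_mult)
    qed simp
    then show "AE x in \<nu>. norm (?I x) \<le> norm (x\<^sup>2)" by simp
  qed simp
  have split3: "sum f {..<?m} = f 0 + f 1 + sum f {2..<?m}" for f :: "nat \<Rightarrow> complex"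
  proof -
    have "{..<?m} = insert 0 (insert 1 {2..<?m})" by auto
    then show ?thesis by (simp only:) simp
  qed
  have R: "?R u x = ?K u x - \<i> * complex_of_real u * of_real (?I x)
      - (\<Sum>k=2..<?m. (\<i> * complex_of_real u) ^ k / fact k * of_real (x ^ k))" for u x
    unfolding split3
    by (simp add: indicator_def power_mult_distrib field_simps cong: sum.cong)
  have intc: "integrable \<nu> (\<lambda>x. \<Sum>k=2..<?m. (\<i> * complex_of_real u) ^ k / fact k * of_real (x ^ k))" for u
    by (intro Bochner_Integration.integrable_sum integrable_mult_right integrable_of_real int) auto
  have "?\<psi> u - (\<Sum>k<?m. ?F $ k * of_real u ^ k) = (CLINT x|\<nu>. ?R u x)" for u
  proof -
    have "(CLINT x|\<nu>. ?R u x) = (CLINT x|\<nu>. ?K u x) - \<i> * complex_of_real u * of_real (LINT x|\<nu>. ?I x)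
        - (\<Sum>k=2..<?m. (\<i> * complex_of_real u) ^ k / fact k * of_real (levy_moment \<nu> k))"
    proof -
      have b: "integrable \<nu> (\<lambda>x. \<i> * complex_of_real u * of_real (?I x))"
        by (intro integrable_mult_right integrable_of_real intI)
      have "(CLINT x|\<nu>. ?R u x) = (CLINT x|\<nu>. ?K u x) - (CLINT x|\<nu>. \<i> * complex_of_real u * of_real (?I x))
          - (CLINT x|\<nu>. \<Sum>k=2..<?m. (\<i> * complex_of_real u) ^ k / fact k * of_real (x ^ k))"
        unfolding R Bochner_Integration.integral_diff[OF Bochner_Integration.integrable_diff[OF
              integrable_levy_kernel[OF nu, of u] b] intc[of u]]
        unfolding Bochner_Integration.integral_diff[OF integrable_levy_kernel[OF nu, of u] b] ..
      also have "(CLINT x|\<nu>. \<Sum>k=2..<?m. (\<i> * complex_of_real u) ^ k / fact k * of_real (x ^ k)) =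
          (\<Sum>k=2..<?m. CLINT x|\<nu>. (\<i> * complex_of_real u) ^ k / fact k * of_real (x ^ k))"
        by (intro Bochner_Integration.integral_sum integrable_mult_right integrable_of_real int) auto
      finally show ?thesis
        by (simp only: integral_mult_right_zero integral_complex_of_real levy_moment_def)
    qed
    moreover have "(\<Sum>k=2..<?m. ?F $ k * of_real u ^ k) =
        (\<Sum>k=2..<?m. (\<i> * complex_of_real u) ^ k / fact k * of_real (levy_moment \<nu> k))
        - complex_of_real (\<sigma>\<^sup>2 * u\<^sup>2 / 2)"
    proof -
      have "?F $ k * of_real u ^ k = (\<i> * complex_of_real u) ^ k / fact k * of_real (levy_moment \<nu> k)
          - (if k = 2 then complex_of_real (\<sigma>\<^sup>2 * u\<^sup>2 / 2) else 0)" if "k \<in> {2..<?m}" for k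
        using that by (auto simp: exponent_cumulant_def cumulant_def power_mult_distrib field_simps)
      then have "(\<Sum>k=2..<?m. ?F $ k * of_real u ^ k) =
         (\<Sum>k=2..<?m. (\<i> * complex_of_real u) ^ k / fact k * of_real (levy_moment \<nu> k)
          - (if k = 2 then complex_of_real (\<sigma>\<^sup>2 * u\<^sup>2 / 2) else 0))"
        by (rule sum.cong[OF refl])
      then show ?thesis by (simp add: sum_subtractf)
    qed
    moreover have "?F $ 0 * of_real u ^ 0 = 0"
      "?F $ 1 * of_real u ^ 1 = \<i> * of_real (\<gamma> * u) + \<i> * complex_of_real u * of_real (LINT x|\<nu>. ?I x)"
      by (simp_all add: exponent_cumulant_def algebra_simps)
    ultimately show ?thesis
      unfolding split3[of "\<lambda>k. ?F $ k * of_real u ^ k"] levy_exponent_def by simp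
  qed
  moreover have "norm (CLINT x|\<nu>. ?R u x) \<le> (LINT x|\<nu>. \<bar>x ^ ?m\<bar>) / fact ?m * norm (complex_of_real u ^ ?m)" for u
  proof -
    have le: "norm (?R u x) \<le> \<bar>u\<bar> ^ ?m / fact ?m * \<bar>x ^ ?m\<bar>" for x
    proof -
      have "Suc (n + 2) = ?m" by simp
      moreover have "{..n + 2} = {..<?m}" by auto
      moreover have "\<bar>u * x\<bar> ^ ?m = \<bar>u\<bar> ^ ?m * \<bar>x ^ ?m\<bar>"
        by (simp only: abs_mult power_mult_distrib power_abs)
      ultimately show ?thesis using iexp_approx1[of "u * x" "n + 2"] by (simp only: times_divide_eq_left)
    qed
    have bd: "integrable \<nu> (\<lambda>x. \<bar>u\<bar> ^ ?m / fact ?m * \<bar>x ^ ?m\<bar>)"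
      by (intro integrable_mult_right integrable_abs int) simp
    have "norm (CLINT x|\<nu>. ?R u x) \<le> (LINT x|\<nu>. \<bar>u\<bar> ^ ?m / fact ?m * \<bar>x ^ ?m\<bar>)"
    proof (rule Bochner_Integration.integral_norm_bound_integral[OF _ bd])
      show "integrable \<nu> (?R u)"
        by (rule Bochner_Integration.integrable_bound[OF bd]) (use le in auto)
    qed (rule le)
    then show ?thesis by (simp add: norm_power mult.commute)
  qed
  ultimately show "(\<lambda>u. ?\<psi> u - (\<Sum>k<?m. ?F $ k * of_real u ^ k)) \<in> O[nhds 0](\<lambda>u. of_real u ^ ?m)"
    by (intro bigoI[where c = "(LINT x|\<nu>. \<bar>x ^ ?m\<bar>) / fact ?m"] always_eventually allI) simp
qed

text \<open>The characteristic function has two expansions, the moment series A and exp (r \<Psi>);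
  uniqueness identifies them. Differentiation gives A' = r \<Psi>' A, and the powers of i cancel
  when coefficients are compared.\<close>

lemma moment_recursion:
  fixes M :: "'a measure" and X :: "'a \<Rightarrow> real"
  assumes M: "prob_space M" and X: "X \<in> borel_measurable M" "\<And>k. integrable M (\<lambda>\<omega>. X \<omega> ^ k)"
    and \<psi>: "has_taylor \<psi> (egf (\<lambda>k. \<i> ^ k * of_real (c k)))" "c 0 = 0"
    and char: "\<And>u. char (distr M borel X) u = exp (of_real r * \<psi> u)"
  shows "integral\<^sup>L M (\<lambda>\<omega>. X \<omega> ^ Suc n) =
    r * (\<Sum>j\<le>n. real (n choose j) * c (Suc j) * integral\<^sup>L M (\<lambda>\<omega>. X \<omega> ^ (n - j)))"
proof -
  define \<mu> where "\<mu> k = integral\<^sup>L M (\<lambda>\<omega>. X \<omega> ^ k)" for k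
  let ?A = "egf (\<lambda>k. \<i> ^ k * complex_of_real (\<mu> k))" and ?\<Psi> = "egf (\<lambda>k. \<i> ^ k * complex_of_real (c k))"
  have "char (distr M borel X) = (\<lambda>u. exp (of_real r * \<psi> u))" using char by auto
  with has_taylor_char[OF M X] have "has_taylor (\<lambda>u. exp (of_real r * \<psi> u)) ?A"
    unfolding \<mu>_def by simp
  moreover have \<Psi>0: "?\<Psi> $ 0 = 0" using \<psi>(2) by simp
  then have "has_taylor (\<lambda>u. exp (of_real r * \<psi> u)) (fps_exp (of_real r) oo ?\<Psi>)"
    by (rule has_taylor_compose[OF has_fps_expansion_exp \<psi>(1)])
  ultimately have A: "?A = fps_exp (of_real r) oo ?\<Psi>" by (rule has_taylor_unique)
  have "fps_deriv ?A = fps_const (of_real r) * (fps_deriv ?\<Psi> * ?A)"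
  proof -
    have "fps_deriv ?A = (fps_deriv (fps_exp (of_real r)) oo ?\<Psi>) * fps_deriv ?\<Psi>"
      unfolding A by (rule fps_compose_deriv[OF \<Psi>0])
    also have "fps_deriv (fps_exp (of_real r)) oo ?\<Psi> = fps_const (of_real r) * ?A"
      unfolding A fps_exp_deriv fps_compose_mult_distrib[OF \<Psi>0] by simp
    finally show ?thesis by (simp only: mult_ac)
  qed
  then have "fps_deriv ?A $ n * fact n = (fps_const (of_real r) * (fps_deriv ?\<Psi> * ?A)) $ n * fact n"
    by simp
  then have "\<i> ^ Suc n * complex_of_real (\<mu> (Suc n)) = of_real r *
      (\<Sum>j\<le>n. of_nat (n choose j) * (\<i> ^ Suc j * of_real (c (Suc j))) * (\<i> ^ (n - j) * of_real (\<mu> (n - j))))"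
    by (simp add: fps_deriv_egf egf_mult_nth)
  also have "\<dots> = \<i> ^ Suc n * of_real (r * (\<Sum>j\<le>n. real (n choose j) * c (Suc j) * \<mu> (n - j)))"
  proof -
    have "of_nat (n choose j) * (\<i> ^ Suc j * of_real (c (Suc j))) * (\<i> ^ (n - j) * of_real (\<mu> (n - j))) =
        \<i> ^ Suc n * of_real (real (n choose j) * c (Suc j) * \<mu> (n - j))" if "j \<le> n" for j
    proof -
      have "\<i> ^ Suc n = \<i> ^ Suc j * \<i> ^ (n - j)" using that by (simp flip: power_add)
      then show ?thesis by simp
    qed
    then have "(\<Sum>j\<le>n. of_nat (n choose j) * (\<i> ^ Suc j * of_real (c (Suc j))) * (\<i> ^ (n - j) * of_real (\<mu> (n - j)))) =
        (\<Sum>j\<le>n. \<i> ^ Suc n * of_real (real (n choose j) * c (Suc j) * \<mu> (n - j)))"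
      by (intro sum.cong) auto
    then show ?thesis by (simp only: sum_distrib_left[symmetric] of_real_sum of_real_mult mult.left_commute)
  qed
  finally have "complex_of_real (\<mu> (Suc n)) = of_real (r * (\<Sum>j\<le>n. real (n choose j) * c (Suc j) * \<mu> (n - j)))"
    by simp
  then show ?thesis unfolding of_real_eq_iff \<mu>_def .
qed

section \<open>Moments of a centered Levy process\<close>

locale centered_levy_process = levy_process M X for M :: "'a measure" and X +
  fixes \<gamma> \<sigma> :: real and \<nu> :: "real measure"
  assumes centered: "centered M X"
    and moments: "finite_moments M X"
    and triplet: "has_levy_triplet M X \<gamma> \<sigma> \<nu>"
begin

lemma levy_measure: "levy_measure \<nu>"
  using triplet by (simp add: has_levy_triplet_def)

lemma integrable_power: "0 \<le> t \<Longrightarrow> integrable M (\<lambda>\<omega>. X t \<omega> ^ n)"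
proof (cases n)
  case (Suc m)
  assume t: "0 \<le> t"
  have "integrable M (\<lambda>\<omega>. \<bar>X t \<omega>\<bar> powr real n)"
    using moments t Suc by (simp add: finite_moments_def)
  moreover have "\<bar>X t \<omega>\<bar> powr real n = \<bar>X t \<omega> ^ n\<bar>" for \<omega>
    using Suc by (cases "X t \<omega> = 0") (simp_all add: powr_realpow power_abs del: of_nat_Suc power_Suc)
  ultimately have "integrable M (\<lambda>\<omega>. \<bar>X t \<omega> ^ n\<bar>)" by simp
  then show ?thesis
    by (rule integrable_abs_cancel) (use random_variable_X[OF t] in measurable)
qed simp

lemma char_X:
  assumes "0 \<le> t"
  shows "char (distr M borel (X t)) u = exp (complex_of_real t * levy_exponent \<gamma> \<sigma> \<nu> u)"
  using triplet assms by (simp add: has_levy_triplet_def levy_exponent_def)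

text \<open>The moments of \<open>X 1\<close> expand its characteristic function, whose modulus
  yields the even moments of \<open>\<nu>\<close>; the other orders follow by domination.\<close>

lemma integrable_levy_measure_power:
  assumes "2 \<le> n"
  shows "integrable \<nu> (\<lambda>x. x ^ n)"
proof (rule integrable_power_of_even[OF levy_measure _ assms])
  fix k :: nat assume k: "k > 0"
  have "char (distr M borel (X 1)) = (\<lambda>u. exp (levy_exponent \<gamma> \<sigma> \<nu> u))"
    using char_X[of 1] by auto
  moreover have "has_taylor (char (distr M borel (X 1))) (egf (\<lambda>k. \<i> ^ k * of_real (expectation (\<lambda>\<omega>. X 1 \<omega> ^ k))))"
    by (intro has_taylor_char prob_space_axioms random_variable_X integrable_power) auto
  ultimately have "has_taylor (\<lambda>u. exp (levy_exponent \<gamma> \<sigma> \<nu> u)) (egf (\<lambda>k. \<i> ^ k * of_real (expectation (\<lambda>\<omega>. X 1 \<omega> ^ k))))"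
    by simp
  from has_taylor_integral_1_minus_cos[OF levy_measure this]
  show "integrable \<nu> (\<lambda>x. x ^ (2 * k))"
    using integrable_even_power[OF levy_measure k] by blast
qed

lemma expectation_power_Suc:
  assumes t: "0 \<le> t"
  shows "expectation (\<lambda>\<omega>. X t \<omega> ^ Suc n) =
    t * (\<Sum>j\<le>n. real (n choose j) * cumulant \<sigma> \<nu> (Suc j) * expectation (\<lambda>\<omega>. X t \<omega> ^ (n - j)))"
proof -
  have rec: "expectation (\<lambda>\<omega>. X t \<omega> ^ Suc n) =
      t * (\<Sum>j\<le>n. real (n choose j) * exponent_cumulant \<gamma> \<sigma> \<nu> (Suc j) * expectation (\<lambda>\<omega>. X t \<omega> ^ (n - j)))"
    if "0 \<le> t" for t n
    by (rule moment_recursion[OF prob_space_axioms random_variable_X[OF that] integrable_power[OF that]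
          has_taylor_levy_exponent[OF levy_measure integrable_levy_measure_power] _ char_X[OF that]])
      (simp_all add: exponent_cumulant_def)
  \<comment> \<open>At \<open>t = 1\<close> and \<open>n = 0\<close> the recursion equates this
    number with the mean of \<open>X 1\<close>; centering makes it 0, that is, the drift compensates
    the large jumps.\<close>
  have "exponent_cumulant \<gamma> \<sigma> \<nu> 1 = 0"
    using rec[of 1 0] centered by (simp add: centered_def prob_space)
  then have "exponent_cumulant \<gamma> \<sigma> \<nu> (Suc j) = cumulant \<sigma> \<nu> (Suc j)" for j
    by (cases j) (simp_all add: exponent_cumulant_def cumulant_def)
  with rec[OF t] show ?thesis by simp
qed

text \<open>The moment series solves B' = t K' B, and the generating function at
  \<open>x = 0\<close> solves G' = - t K' G, so B G has derivative 0. Its coefficient of degree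
  \<open>n\<close> is the expectation divided by n!.\<close>

lemma expectation_ts_poly:
  assumes t: "0 \<le> t" and n: "1 \<le> n"
  shows "expectation (\<lambda>\<omega>. ts_poly \<sigma> \<nu> n (X t \<omega>) t) = 0"
proof -
  let ?\<mu> = "\<lambda>k. expectation (\<lambda>\<omega>. X t \<omega> ^ k)" and ?\<kappa> = "\<lambda>k. t * cumulant \<sigma> \<nu> k"
  let ?B = "egf ?\<mu>" and ?G = "egf (\<lambda>n. Gamma_poly n (ts_args \<sigma> \<nu> 0 t))"
  have "fps_deriv ?B = egf (\<lambda>k. ?\<kappa> (Suc k)) * ?B"
    by (rule fps_ext) (simp add: fps_deriv_egf egf_mult_nth expectation_power_Suc[OF t] sum_distrib_left mult_ac del: power_Suc)
  moreover have "fps_deriv ?G = - egf (\<lambda>k. ?\<kappa> (Suc k)) * ?G"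
  proof -
    have "egf (\<lambda>k. ts_args \<sigma> \<nu> 0 t (Suc k)) = - egf (\<lambda>k. ?\<kappa> (Suc k))"
      by (rule fps_ext) (auto simp: ts_args_def cumulant_def field_simps)
    then show ?thesis by (simp add: fps_deriv_egf_Gamma_poly)
  qed
  ultimately have "fps_deriv (?B * ?G) = 0" by (simp add: algebra_simps)
  then obtain c where "?B * ?G = fps_const c" unfolding fps_deriv_eq_0_iff by blast
  then have "(?B * ?G) $ n = 0" using n by simp
  then have "(\<Sum>j\<le>n. real (n choose j) * ?\<mu> j * Gamma_poly (n - j) (ts_args \<sigma> \<nu> 0 t)) = 0"
    unfolding egf_mult_nth by simp
  also have "(\<Sum>j\<le>n. real (n choose j) * ?\<mu> j * Gamma_poly (n - j) (ts_args \<sigma> \<nu> 0 t)) =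
      expectation (\<lambda>\<omega>. ts_poly \<sigma> \<nu> n (X t \<omega>) t)"
    unfolding ts_poly_explicit atLeast0AtMost
    by (subst Bochner_Integration.integral_sum)
      (auto intro!: integrable_mult_right integrable_power t sum.cong)
  finally show ?thesis .
qed

end

section \<open>Independence of the increments from the past\<close>

context levy_process
begin

abbreviation filtration :: "real \<Rightarrow> 'a measure" where
  "filtration \<equiv> natural_filtration M X"

lemma space_filtration [simp]: "space (filtration t) = space M"
  by (simp add: natural_filtration_def space_measure_of_conv)

lemma sets_filtration:
  "sets (filtration t) = sigma_sets (space M) {X s -` A \<inter> space M | s A. 0 \<le> s \<and> s \<le> t \<and> A \<in> sets borel}"
  unfolding natural_filtration_def by (rule sets_measure_of) auto

lemma subalgebra_filtration: "subalgebra M (filtration t)"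
proof -
  have "sets (filtration t) \<subseteq> sets M"
    unfolding sets_filtration
    by (rule sets.sigma_sets_subset) (use random_variable_X in \<open>auto intro: measurable_sets\<close>)
  then show ?thesis by (simp add: subalgebra_def)
qed

lemma sigma_finite_subalgebra_filtration: "sigma_finite_subalgebra M (filtration s)"
  by (rule finite_measure_subalgebra_is_sigma_finite)
    (simp add: finite_measure_subalgebra_def finite_measure_subalgebra_axioms_def
      finite_measure_axioms subalgebra_filtration)

lemma subalgebra_filtration_mono:
  assumes "s \<le> t"
  shows "subalgebra (filtration t) (filtration s)"
proof -
  have "sets (filtration s) \<subseteq> sets (filtration t)"
    unfolding sets_filtration by (rule sigma_sets_mono') (use assms in fastforce)
  then show ?thesis by (simp add: subalgebra_def)
qed

lemma measurable_filtration:
  assumes "0 \<le> s" "s \<le> t"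
  shows "X s \<in> borel_measurable (filtration t)"
proof (rule measurableI)
  fix A :: "real set" assume "A \<in> sets borel"
  then show "X s -` A \<inter> space (filtration t) \<in> sets (filtration t)"
    unfolding space_filtration sets_filtration using assms by (intro sigma_sets.Basic) blast
qed auto

text \<open>An intersection-stable generator of the filtration. The sets \<open>A r\<close> are
  indexed by all times, so cylinders with different \<open>J\<close> can be intersected after
  padding with \<open>UNIV\<close>.\<close>

definition cylinders :: "real \<Rightarrow> 'a set set" where
  "cylinders s = {{\<omega> \<in> space M. \<forall>r\<in>J. X r \<omega> \<in> A r} | J A.
     finite J \<and> J \<subseteq> {0..s} \<and> (\<forall>r. A r \<in> sets borel)}"

lemma cylinder_event:
  assumes "finite J" "J \<subseteq> {0..s}" "\<And>r. A r \<in> sets borel"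
  shows "{\<omega> \<in> space M. \<forall>r\<in>J. X r \<omega> \<in> A r} \<in> events"
proof (rule sets.sets_Collect_finite_All[OF _ assms(1)])
  fix r assume "r \<in> J"
  then have "random_variable borel (X r)" using assms(2) by (intro random_variable_X) auto
  from measurable_sets[OF this assms(3)[of r]]
  show "{\<omega> \<in> space M. X r \<omega> \<in> A r} \<in> events" by (simp add: vimage_def Int_def conj_commute)
qed

lemma Int_stable_cylinders: "Int_stable (cylinders s)"
proof (rule Int_stableI)
  fix C C' assume "C \<in> cylinders s" "C' \<in> cylinders s"
  then obtain J A J' A' where C: "C = {\<omega> \<in> space M. \<forall>r\<in>J. X r \<omega> \<in> A r}"
      "C' = {\<omega> \<in> space M. \<forall>r\<in>J'. X r \<omega> \<in> A' r}"
    and J: "finite J" "J \<subseteq> {0..s}" "finite J'" "J' \<subseteq> {0..s}"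
      "\<And>r. A r \<in> sets borel" "\<And>r. A' r \<in> sets borel"
    unfolding cylinders_def by blast
  let ?A = "\<lambda>r. (if r \<in> J then A r else UNIV) \<inter> (if r \<in> J' then A' r else UNIV)"
  have "C \<inter> C' = {\<omega> \<in> space M. \<forall>r\<in>J \<union> J'. X r \<omega> \<in> ?A r}"
    unfolding C by auto
  then show "C \<inter> C' \<in> cylinders s"
    unfolding cylinders_def using J by (intro CollectI exI[of _ "J \<union> J'"] exI[of _ ?A]) auto
qed

lemma sets_filtration_subset_cylinders: "sets (filtration s) \<subseteq> sigma_sets (space M) (cylinders s)"
  unfolding sets_filtration
proof (rule sigma_sets_mono', safe)
  fix r A assume "0 \<le> r" "r \<le> s" "A \<in> sets (borel :: real measure)"
  then show "X r -` A \<inter> space M \<in> cylinders s"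
    unfolding cylinders_def by (intro CollectI exI[of _ "{r}"] exI[of _ "\<lambda>_. A"]) auto
qed

text \<open>Along a grid through 0, the times in \<open>J\<close>, \<open>s\<close> and
  \<open>t\<close>, each \<open>X r\<close> with \<open>r\<close> in \<open>J\<close> is
  \<open>X 0\<close> plus a sum of increments before \<open>s\<close>, while \<open>H\<close>
  concerns the last increment only. Independence of the grid increments factorises the
  probability.\<close>

lemma prob_cylinder_increment:
  assumes st: "0 \<le> s" "s < t" and J: "finite J" "J \<subseteq> {0..s}" and A: "\<And>r. A r \<in> sets borel"
    and B: "B \<in> sets borel"
  defines "C \<equiv> {\<omega> \<in> space M. \<forall>r\<in>J. X r \<omega> \<in> A r}"
    and "H \<equiv> (\<lambda>\<omega>. X t \<omega> - X s \<omega>) -` B \<inter> space M"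
  shows "prob (C \<inter> H) = prob C * prob H"
proof -
  \<comment> \<open>Sorting the set removes repetitions, as the grid must be strictly increasing.
    The point 0 starts the telescoping sums, and \<open>s\<close> makes \<open>X t - X s\<close> a
    single increment.\<close>
  define L where "L = sorted_list_of_set (insert 0 (insert s J))"
  define n where "n = length L - 1"
  have fin: "finite (insert 0 (insert s J))" using J by simp
  have L: "sorted_wrt (<) L" "set L = insert 0 (insert s J)"
    unfolding L_def by (rule strict_sorted_list_of_set, rule set_sorted_list_of_set[OF fin])
  have len: "length L = Suc n" using L(2) unfolding n_def by (cases L) auto
  define \<tau> where "\<tau> i = (L @ [t]) ! i" for i
  have \<tau>L: "\<tau> i = L ! i" if "i \<le> n" for i using that len by (simp add: \<tau>_def nth_append)
  have \<tau>t: "\<tau> (Suc n) = t" using len by (simp add: \<tau>_def nth_append)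
  have mono: "L ! i \<le> L ! j" if "i \<le> j" "j \<le> n" for i j
    using that L(1) len sorted_wrt_nth_less[OF L(1), of i j] by (cases "i = j") auto
  have Lrange: "0 \<le> x \<and> x \<le> s" if "x \<in> set L" for x using that L(2) J st by auto
  have \<tau>0: "\<tau> 0 = 0"
  proof -
    obtain i where "i \<le> n" "L ! i = 0" using L(2) len by (metis in_set_conv_nth insertI1 less_Suc_eq_le)
    then have "L ! 0 \<le> 0" using mono[of 0 i] by simp
    then show ?thesis using Lrange[of "L ! 0"] len \<tau>L[of 0] by (metis le0 nth_mem antisym zero_less_Suc)
  qed
  have \<tau>n: "\<tau> n = s"
  proof -
    obtain i where "i \<le> n" "L ! i = s" using L(2) len by (metis in_set_conv_nth insertI1 insertI2 less_Suc_eq_le)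
    then have "s \<le> L ! n" using mono[of i n] by simp
    then show ?thesis using Lrange[of "L ! n"] len \<tau>L[of n] by (metis antisym lessI nth_mem order_refl)
  qed
  have \<tau>step: "\<tau> i < \<tau> (Suc i)" if "i < Suc n" for i
  proof (cases "i = n")
    case True then show ?thesis using \<tau>n \<tau>t st by simp
  next
    case False then show ?thesis
      using that sorted_wrt_nth_less[OF L(1), of i "Suc i"] len \<tau>L[of i] \<tau>L[of "Suc i"] by simp
  qed
  define D where "D i \<omega> = X (\<tau> (Suc i)) \<omega> - X (\<tau> i) \<omega>" for i \<omega>
  have ind: "indep_vars (\<lambda>_. borel) D {..<Suc n}"
    unfolding D_def by (rule independent_increments) (use \<tau>0 \<tau>step in auto)
  have iv: "indep_var (PiM {..<n} (\<lambda>_. borel)) (\<lambda>\<omega>. restrict (\<lambda>i. D i \<omega>) {..<n})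
      (PiM {n} (\<lambda>_. borel)) (\<lambda>\<omega>. restrict (\<lambda>i. D i \<omega>) {n})"
    by (rule indep_var_restrict[OF ind]) auto
  have tele: "X (\<tau> k) \<omega> - X 0 \<omega> = (\<Sum>i<k. D i \<omega>)" for k \<omega>
    using sum_lessThan_telescope[of "\<lambda>i. X (\<tau> i) \<omega>" k] \<tau>0 by (simp add: D_def)
  have "\<exists>k. k \<le> n \<and> \<tau> k = r" if "r \<in> J" for r
  proof -
    have "r \<in> set L" using that L(2) by simp
    then obtain k where "k < Suc n" "L ! k = r" using len by (auto simp: in_set_conv_nth)
    then show ?thesis using \<tau>L[of k] by (auto simp: less_Suc_eq_le)
  qed
  then obtain idx where idx: "\<And>r. r \<in> J \<Longrightarrow> idx r \<le> n" "\<And>r. r \<in> J \<Longrightarrow> \<tau> (idx r) = r" by metis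
  define E where "E = {f \<in> space (PiM {..<n} (\<lambda>_. borel :: real measure)). \<forall>r\<in>J. (\<Sum>i<idx r. f i) \<in> A r}"
  have E: "E \<in> sets (PiM {..<n} (\<lambda>_. borel))"
    unfolding E_def
  proof (rule sets.sets_Collect_finite_All[OF _ J(1)])
    fix r assume r: "r \<in> J"
    have "(\<lambda>f. \<Sum>i<idx r. f i) \<in> borel_measurable (PiM {..<n} (\<lambda>_. borel :: real measure))"
      by (intro borel_measurable_sum measurable_component_singleton) (use idx(1)[OF r] in auto)
    from measurable_sets[OF this A[of r]]
    show "{f \<in> space (PiM {..<n} (\<lambda>_. borel :: real measure)). (\<Sum>i<idx r. f i) \<in> A r} \<in> sets (PiM {..<n} (\<lambda>_. borel))"
      by (simp add: vimage_def Int_def conj_commute)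
  qed
  define E2 where "E2 = {f \<in> space (PiM {n} (\<lambda>_. borel :: real measure)). f n \<in> B}"
  have E2: "E2 \<in> sets (PiM {n} (\<lambda>_. borel))"
    unfolding E2_def using B by measurable
  \<comment> \<open>\<open>X 0 = 0\<close> holds only almost surely, so \<open>C\<close> is replaced
    by an event in the increments alone.\<close>
  define C' where "C' = {\<omega> \<in> space M. \<forall>r\<in>J. X r \<omega> - X 0 \<omega> \<in> A r}"
  have C': "C' = (\<lambda>\<omega>. restrict (\<lambda>i. D i \<omega>) {..<n}) -` E \<inter> space M"
  proof -
    have "(\<Sum>i<idx r. restrict (\<lambda>i. D i \<omega>) {..<n} i) = X r \<omega> - X 0 \<omega>" if "r \<in> J" for r \<omega>
    proof -
      have "(\<Sum>i<idx r. restrict (\<lambda>i. D i \<omega>) {..<n} i) = (\<Sum>i<idx r. D i \<omega>)"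
        using idx(1)[OF that] by (intro sum.cong) auto
      then show ?thesis using tele[of "idx r" \<omega>] idx(2)[OF that] by simp
    qed
    then show ?thesis by (auto simp: C'_def E_def space_PiM)
  qed
  have H: "H = (\<lambda>\<omega>. restrict (\<lambda>i. D i \<omega>) {n}) -` E2 \<inter> space M"
    by (auto simp: H_def E2_def space_PiM D_def \<tau>t \<tau>n)
  have rv0: "random_variable borel (X 0)" by (rule random_variable_X) simp
  have rvt: "random_variable borel (X t)" "random_variable borel (X s)"
    using st by (auto intro: random_variable_X)
  have Hev: "H \<in> events" unfolding H_def using rvt B by measurable
  have Cev: "C \<in> events" unfolding C_def by (rule cylinder_event[OF J A])
  have C'ev: "C' \<in> events"
    unfolding C' using indep_var_rv1[OF iv] E by (rule measurable_sets)
  have AE: "AE \<omega> in M. \<omega> \<in> C \<longleftrightarrow> \<omega> \<in> C'"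
    using X_zero by eventually_elim (auto simp: C_def C'_def)
  have "prob (C' \<inter> H) = prob C' * prob H"
  proof -
    have "C' \<inter> H = (\<lambda>\<omega>. (restrict (\<lambda>i. D i \<omega>) {..<n}, restrict (\<lambda>i. D i \<omega>) {n})) -` (E \<times> E2) \<inter> space M"
      unfolding C' H by auto
    then show ?thesis using indep_varD[OF iv E E2] C' H by simp
  qed
  moreover have "prob C = prob C'"
    by (rule finite_measure_eq_AE[OF AE Cev C'ev])
  moreover have "prob (C \<inter> H) = prob (C' \<inter> H)"
    using AE by (intro finite_measure_eq_AE sets.Int Cev C'ev Hev) auto
  ultimately show ?thesis by simp
qed

text \<open>Independence passes from intersection-stable generators to the sigma-algebras they
  generate.\<close>

lemma indep_set_filtration_increment:
  assumes st: "0 \<le> s" "s < t"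
  shows "indep_set (sets (filtration s))
    (sigma_sets (space M) {(\<lambda>\<omega>. X t \<omega> - X s \<omega>) -` B \<inter> space M | B. B \<in> sets borel})"
proof -
  let ?D = "\<lambda>\<omega>. X t \<omega> - X s \<omega>"
  let ?H = "{?D -` B \<inter> space M | B. B \<in> sets borel}"
  have rv: "random_variable borel ?D"
    using random_variable_X[of s] random_variable_X[of t] st by simp
  have "indep_set (cylinders s) ?H"
  proof (rule indep_setI)
    show "cylinders s \<subseteq> events" using cylinder_event by (auto simp: cylinders_def)
    show "?H \<subseteq> events" using rv by (auto intro: measurable_sets)
    fix C H assume "C \<in> cylinders s" "H \<in> ?H"
    then show "prob (C \<inter> H) = prob C * prob H"
      using prob_cylinder_increment[OF st] by (auto simp: cylinders_def)
  qed
  moreover have "Int_stable ?H"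
  proof (rule Int_stableI)
    fix H H' assume "H \<in> ?H" "H' \<in> ?H"
    then obtain B B' where "H = ?D -` B \<inter> space M" "H' = ?D -` B' \<inter> space M" "B \<in> sets borel" "B' \<in> sets borel"
      by blast
    then show "H \<inter> H' \<in> ?H" by (intro CollectI exI[of _ "B \<inter> B'"]) auto
  qed
  ultimately have ind: "indep_set (sigma_sets (space M) (cylinders s)) (sigma_sets (space M) ?H)"
    by (rule indep_set_sigma_sets[OF _ Int_stable_cylinders])
  show ?thesis
    using indep_setD[OF ind] indep_setD_ev1[OF ind] indep_setD_ev2[OF ind] sets_filtration_subset_cylinders[of s]
    by (intro indep_setI) auto
qed

lemma indep_var_filtration_increment:
  assumes st: "0 \<le> s" "s < t" and Y: "Y \<in> borel_measurable (filtration s)"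
  shows "indep_var borel Y borel (\<lambda>\<omega>. X t \<omega> - X s \<omega>)"
  unfolding indep_var_eq
proof (intro conjI)
  show "random_variable borel Y"
    by (rule measurable_from_subalg[OF subalgebra_filtration Y])
  show "random_variable borel (\<lambda>\<omega>. X t \<omega> - X s \<omega>)"
    using random_variable_X[of s] random_variable_X[of t] st by simp
  have "sigma_sets (space (filtration s)) {Y -` A \<inter> space M |A. A \<in> sets borel} \<subseteq> sets (filtration s)"
    by (rule sets.sigma_sets_subset) (use measurable_sets[OF Y] in auto)
  then show "indep_set (sigma_sets (space M) {Y -` A \<inter> space M |A. A \<in> sets borel})
     (sigma_sets (space M) {(\<lambda>\<omega>. X t \<omega> - X s \<omega>) -` A \<inter> space M |A. A \<in> sets borel})"
    using indep_setD[OF indep_set_filtration_increment[OF st]]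
      indep_setD_ev1[OF indep_set_filtration_increment[OF st]]
      indep_setD_ev2[OF indep_set_filtration_increment[OF st]]
    by (intro indep_setI) auto
qed

end

section \<open>The martingale property\<close>

context centered_levy_process
begin

abbreviation Q :: "nat \<Rightarrow> real \<Rightarrow> real \<Rightarrow> real" where
  "Q \<equiv> ts_poly \<sigma> \<nu>"

lemma integrable_ts_poly: "0 \<le> s \<Longrightarrow> integrable M (\<lambda>\<omega>. Q n (X s \<omega>) t)"
  unfolding ts_poly_explicit by (intro Bochner_Integration.integrable_sum integrable_mult_right integrable_power)

lemma measurable_ts_poly: "f \<in> borel_measurable N \<Longrightarrow> (\<lambda>\<omega>. Q n (f \<omega>) t) \<in> borel_measurable N"
  unfolding ts_poly_explicit by simp

text \<open>By stationarity the increment has the law of \<open>X (t - s)\<close>, to which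
  \<open>expectation_ts_poly\<close> applies.\<close>

lemma
  assumes "0 \<le> s" "s < t"
  shows expectation_ts_poly_increment:
      "expectation (\<lambda>\<omega>. Q n (X t \<omega> - X s \<omega>) (t - s)) = (if n = 0 then 1 else 0)"
    and integrable_ts_poly_increment: "integrable M (\<lambda>\<omega>. Q n (X t \<omega> - X s \<omega>) (t - s))"
proof -
  let ?f = "\<lambda>x. Q n x (t - s)"
  have f: "?f \<in> borel_measurable borel" by (rule measurable_ts_poly) simp
  have X: "random_variable borel (X (t - s))" "random_variable borel (\<lambda>\<omega>. X t \<omega> - X s \<omega>)"
    using assms random_variable_X by (auto intro: random_variable_X)
  have d: "distr M borel (\<lambda>\<omega>. X t \<omega> - X s \<omega>) = distr M borel (X (t - s))"
    using assms by (intro stationary_increments) auto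
  have "expectation (\<lambda>\<omega>. ?f (X t \<omega> - X s \<omega>)) = expectation (\<lambda>\<omega>. ?f (X (t - s) \<omega>))"
    using integral_distr[OF X(1) f] integral_distr[OF X(2) f] d by simp
  then show "expectation (\<lambda>\<omega>. Q n (X t \<omega> - X s \<omega>) (t - s)) = (if n = 0 then 1 else 0)"
    using expectation_ts_poly[of "t - s" n] assms by (simp add: ts_poly_0 prob_space)
  show "integrable M (\<lambda>\<omega>. ?f (X t \<omega> - X s \<omega>))"
    using integrable_distr_eq[OF X(1) f] integrable_distr_eq[OF X(2) f] d integrable_ts_poly[of "t - s" n "t - s"] assms
    by simp
qed

text \<open>Over an event \<open>A\<close> of the past, the addition formula at
  \<open>X s + (X t - X s)\<close> and \<open>s + (t - s)\<close> gives products of a past factor,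
  carrying the indicator of \<open>A\<close>, and an independent factor in the increment.
  Expectations factorise, and only \<open>j = n\<close> survives because \<open>Q k\<close> of the
  increment has mean 0 for \<open>k > 0\<close>.\<close>

lemma cond_exp_ts_poly:
  assumes st: "0 \<le> s" "s \<le> t"
  shows "AE \<omega> in M. real_cond_exp M (filtration s) (\<lambda>\<omega>. Q n (X t \<omega>) t) \<omega> = Q n (X s \<omega>) s"
\<comment> \<open>The independence of the increment is available for \<open>s < t\<close>; at
  \<open>s = t\<close> the variable is already measurable.\<close>
proof (cases "s = t")
  case True
  show ?thesis
    unfolding True using st(1) True
    by (intro sigma_finite_subalgebra.real_cond_exp_F_meas sigma_finite_subalgebra_filtration
        integrable_ts_poly measurable_ts_poly measurable_filtration) auto
next
  case False
  then have st': "s < t" using st by simp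
  let ?D = "\<lambda>\<omega>. X t \<omega> - X s \<omega>"
  show ?thesis
  proof (rule sigma_finite_subalgebra.real_cond_exp_charact[OF sigma_finite_subalgebra_filtration])
    show "integrable M (\<lambda>\<omega>. Q n (X t \<omega>) t)" "integrable M (\<lambda>\<omega>. Q n (X s \<omega>) s)"
      using st by (auto intro: integrable_ts_poly)
    show "(\<lambda>\<omega>. Q n (X s \<omega>) s) \<in> borel_measurable (filtration s)"
      using st by (intro measurable_ts_poly measurable_filtration) auto
    fix A assume A: "A \<in> sets (filtration s)"
    then have AM: "A \<in> events" using subalgebra_filtration[of s] by (auto simp: subalgebra_def)
    let ?Y = "\<lambda>j \<omega>. indicator A \<omega> * Q j (X s \<omega>) s" and ?Z = "\<lambda>k \<omega>. Q k (?D \<omega>) (t - s)"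
    have Y: "?Y j \<in> borel_measurable (filtration s)" for j
      using A st by (intro borel_measurable_times borel_measurable_indicator measurable_ts_poly measurable_filtration) auto
    have Yi: "integrable M (?Y j)" for j
      using integrable_mult_indicator[OF AM integrable_ts_poly[OF st(1), of j s]] by simp
    have ind: "indep_var borel (?Y j) borel (?Z k)" for j k
    proof -
      have "(\<lambda>x. Q k x (t - s)) \<in> borel_measurable borel" by (rule measurable_ts_poly) simp
      from indep_var_compose[OF indep_var_filtration_increment[OF st(1) st' Y[of j]] measurable_ident_sets[OF refl] this]
      show ?thesis by (simp add: comp_def)
    qed
    have Zi: "integrable M (?Z k)" for k by (rule integrable_ts_poly_increment[OF st(1) st'])
    have "(\<integral>\<omega>\<in>A. Q n (X t \<omega>) t \<partial>M) = expectation (\<lambda>\<omega>. \<Sum>j\<le>n. real (n choose j) * (?Y j \<omega> * ?Z (n - j) \<omega>))"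
      unfolding set_lebesgue_integral_def
    proof (rule Bochner_Integration.integral_cong)
      fix \<omega>
      show "indicator A \<omega> *\<^sub>R Q n (X t \<omega>) t = (\<Sum>j\<le>n. real (n choose j) * (?Y j \<omega> * ?Z (n - j) \<omega>))"
        using ts_poly_add[of \<sigma> \<nu> n "X s \<omega>" "?D \<omega>" s "t - s"] by (simp add: sum_distrib_left mult_ac)
    qed simp
    also have "\<dots> = (\<Sum>j\<le>n. real (n choose j) * (expectation (?Y j) * expectation (?Z (n - j))))"
      using indep_var_integrable[OF ind Yi Zi] indep_var_lebesgue_integral[OF ind Yi Zi]
      by (subst Bochner_Integration.integral_sum) (auto simp del: mult_eq_0_iff)
    also have "\<dots> = (\<Sum>j\<in>{n}. real (n choose j) * (expectation (?Y j) * expectation (?Z (n - j))))"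
      by (rule sum.mono_neutral_right) (auto simp: expectation_ts_poly_increment[OF st(1) st'])
    also have "\<dots> = (\<integral>\<omega>\<in>A. Q n (X s \<omega>) s \<partial>M)"
      by (simp add: expectation_ts_poly_increment[OF st(1) st'] set_lebesgue_integral_def)
    finally show "(\<integral>\<omega>\<in>A. Q n (X t \<omega>) t \<partial>M) = (\<integral>\<omega>\<in>A. Q n (X s \<omega>) s \<partial>M)" .
  qed
qed

lemma martingale_ts_poly: "martingale M filtration (\<lambda>t \<omega>. Q n (X t \<omega>) t)"
  unfolding martingale_def
  using cond_exp_ts_poly integrable_ts_poly measurable_ts_poly[OF measurable_filtration]
  by (auto intro: subalgebra_filtration subalgebra_filtration_mono)

end

section \<open>Time-space harmonic polynomials form a vector space\<close>

lemmas rpf_linear = real_polynomial_function.intros(1)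
  and rpf_const = real_polynomial_function.intros(2)
  and rpf_add = real_polynomial_function.intros(3)
  and rpf_mult = real_polynomial_function.intros(4)

lemma real_polynomial_function_ts_poly: "real_polynomial_function (\<lambda>(x, t). ts_poly \<sigma> \<nu> n x t)"
proof -
  have "real_polynomial_function (\<lambda>p. ts_poly \<sigma> \<nu> n (fst p) (snd p))"
  proof (induction n rule: less_induct)
    case (less n)
    have X: "real_polynomial_function (fst :: real \<times> real \<Rightarrow> real)"
      and T: "real_polynomial_function (snd :: real \<times> real \<Rightarrow> real)"
      by (intro rpf_linear bounded_linear_fst bounded_linear_snd)+
    show ?case
    proof (cases n)
      case (Suc m)
      show ?thesis
        unfolding Suc ts_poly_Suc
        by (intro real_polynomial_function_diff real_polynomial_function_sum rpf_mult
            rpf_const X T less.IH) (auto simp: Suc)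
    qed (simp add: ts_poly_0 rpf_const)
  qed
  then show ?thesis by (simp add: case_prod_unfold)
qed

context levy_process
begin

lemma time_space_harmonicI:
  assumes "real_polynomial_function (\<lambda>(x, t). f x t)"
    and "\<And>t. 0 \<le> t \<Longrightarrow> (\<lambda>\<omega>. f (X t \<omega>) t) \<in> borel_measurable (filtration t)"
    and "\<And>t. 0 \<le> t \<Longrightarrow> integrable M (\<lambda>\<omega>. f (X t \<omega>) t)"
    and "\<And>s t. 0 \<le> s \<Longrightarrow> s \<le> t \<Longrightarrow>
      AE \<omega> in M. real_cond_exp M (filtration s) (\<lambda>\<omega>. f (X t \<omega>) t) \<omega> = f (X s \<omega>) s"
  shows "time_space_harmonic M X f"
  unfolding time_space_harmonic_def martingale_def
  by (intro conjI allI impI assms subalgebra_filtration subalgebra_filtration_mono)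

lemma time_space_harmonicD:
  assumes "time_space_harmonic M X f"
  shows "real_polynomial_function (\<lambda>(x, t). f x t)"
    and "0 \<le> t \<Longrightarrow> (\<lambda>\<omega>. f (X t \<omega>) t) \<in> borel_measurable (filtration t)"
    and "0 \<le> t \<Longrightarrow> integrable M (\<lambda>\<omega>. f (X t \<omega>) t)"
    and "0 \<le> s \<Longrightarrow> s \<le> t \<Longrightarrow>
      AE \<omega> in M. real_cond_exp M (filtration s) (\<lambda>\<omega>. f (X t \<omega>) t) \<omega> = f (X s \<omega>) s"
  using assms unfolding time_space_harmonic_def martingale_def by blast+

lemma time_space_harmonic_add:
  assumes f: "time_space_harmonic M X f" and g: "time_space_harmonic M X g"
  shows "time_space_harmonic M X (\<lambda>x t. f x t + g x t)"
proof (rule time_space_harmonicI)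
  show "real_polynomial_function (\<lambda>(x, t). f x t + g x t)"
    using rpf_add[OF time_space_harmonicD(1)[OF f] time_space_harmonicD(1)[OF g]]
    by (simp add: case_prod_unfold)
  fix s t :: real assume st: "0 \<le> s" "s \<le> t"
  then have t: "0 \<le> t" by simp
  show "AE \<omega> in M. real_cond_exp M (filtration s) (\<lambda>\<omega>. f (X t \<omega>) t + g (X t \<omega>) t) \<omega> = f (X s \<omega>) s + g (X s \<omega>) s"
    using sigma_finite_subalgebra.real_cond_exp_add[OF sigma_finite_subalgebra_filtration[of s]
        time_space_harmonicD(3)[OF f t] time_space_harmonicD(3)[OF g t]]
      time_space_harmonicD(4)[OF f st] time_space_harmonicD(4)[OF g st]
    by eventually_elim simp
qed (intro borel_measurable_add Bochner_Integration.integrable_add time_space_harmonicD f g; assumption)+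

lemma time_space_harmonic_scale:
  assumes f: "time_space_harmonic M X f"
  shows "time_space_harmonic M X (\<lambda>x t. c * f x t)"
proof (rule time_space_harmonicI)
  show "real_polynomial_function (\<lambda>(x, t). c * f x t)"
    using rpf_mult[OF rpf_const[of c] time_space_harmonicD(1)[OF f]]
    by (simp add: case_prod_unfold)
  fix s t :: real assume st: "0 \<le> s" "s \<le> t"
  then have t: "0 \<le> t" by simp
  show "AE \<omega> in M. real_cond_exp M (filtration s) (\<lambda>\<omega>. c * f (X t \<omega>) t) \<omega> = c * f (X s \<omega>) s"
    using sigma_finite_subalgebra.real_cond_exp_cmult[OF sigma_finite_subalgebra_filtration[of s]
        time_space_harmonicD(3)[OF f t]] time_space_harmonicD(4)[OF f st]
    by eventually_elim simp
qed (intro borel_measurable_times borel_measurable_const integrable_mult_right time_space_harmonicD f; assumption)+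

end

lemma (in centered_levy_process) time_space_harmonic_ts_poly: "time_space_harmonic M X (Q n)"
  using real_polynomial_function_ts_poly martingale_ts_poly by (simp add: time_space_harmonic_def)

lemma (in centered_levy_process) subspace_time_space_harmonic: "fun2.subspace {f. time_space_harmonic M X f}"
proof (rule fun2.subspaceI)
  show "0 \<in> {f. time_space_harmonic M X f}"
    using time_space_harmonic_scale[OF time_space_harmonic_ts_poly[of 0], of 0] by (simp add: zero_fun_def)
qed (auto simp: scale_fun2_def plus_fun_def intro: time_space_harmonic_add time_space_harmonic_scale)

lemma (in centered_levy_process) span_ts_poly_subset:
  "fun2.span (range Q) \<subseteq> {f. time_space_harmonic M X f}"
  by (rule fun2.span_minimal) (auto intro: subspace_time_space_harmonic time_space_harmonic_ts_poly)

lemma sum_fun2_apply: "(\<Sum>i\<in>I. F i) x t = (\<Sum>i\<in>I. F i x t :: real)"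
  by (induction I rule: infinite_finite_induct) auto

lemma ts_poly_combination_in_span:
  "(\<lambda>x t. \<Sum>j\<le>N. c j * ts_poly \<sigma> \<nu> j x t) \<in> fun2.span (range (ts_poly \<sigma> \<nu>))"
proof -
  have "(\<Sum>j\<le>N. scale_fun2 (c j) (ts_poly \<sigma> \<nu> j)) \<in> fun2.span (range (ts_poly \<sigma> \<nu>))"
    by (intro fun2.span_sum fun2.span_scale fun2.span_base) auto
  also have "(\<Sum>j\<le>N. scale_fun2 (c j) (ts_poly \<sigma> \<nu> j)) = (\<lambda>x t. \<Sum>j\<le>N. c j * ts_poly \<sigma> \<nu> j x t)"
    by (intro ext) (simp add: sum_fun2_apply scale_fun2_def)
  finally show ?thesis .
qed

section \<open>Expansion of a polynomial along the time-space polynomials\<close>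

text \<open>The \<open>j\<close>-th time-space polynomial is monic of degree \<open>j\<close> in
  \<open>x\<close>, so these polynomials form a basis over the polynomials in \<open>t\<close>,
  which serve as coefficients.\<close>

definition ts_expandable :: "real \<Rightarrow> real measure \<Rightarrow> (real \<Rightarrow> real \<Rightarrow> real) \<Rightarrow> bool" where
  "ts_expandable \<sigma> \<nu> f \<longleftrightarrow>
     (\<exists>N a. (\<forall>j. real_polynomial_function (a j)) \<and> (\<forall>x t. f x t = (\<Sum>j\<le>N. a j t * ts_poly \<sigma> \<nu> j x t)))"

lemma ts_expandableI:
  "(\<And>j. real_polynomial_function (a j)) \<Longrightarrow> (\<And>x t. f x t = (\<Sum>j\<le>N. a j t * ts_poly \<sigma> \<nu> j x t)) \<Longrightarrow>
   ts_expandable \<sigma> \<nu> f"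
  unfolding ts_expandable_def by blast

lemma ts_expandable_term:
  assumes "real_polynomial_function b"
  shows "ts_expandable \<sigma> \<nu> (\<lambda>x t. b t * ts_poly \<sigma> \<nu> n x t)"
proof (rule ts_expandableI[where N = n and a = "\<lambda>j t. if j = n then b t else 0"])
  fix j show "real_polynomial_function (\<lambda>t. if j = n then b t else 0)"
    using assms rpf_const[of 0] by (cases "j = n") auto
qed (simp add: if_distrib[of "\<lambda>y. y * _"] cong: if_cong)

text \<open>Padding with zero coefficients brings two expansions to the same \<open>N\<close> before
  they are added.\<close>

lemma ts_expandable_extend:
  assumes "ts_expandable \<sigma> \<nu> f"
  shows "\<exists>N0. \<forall>N\<ge>N0. \<exists>a. (\<forall>j. real_polynomial_function (a j)) \<and>
    (\<forall>x t. f x t = (\<Sum>j\<le>N. a j t * ts_poly \<sigma> \<nu> j x t))"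
proof -
  obtain N0 a where a: "\<And>j. real_polynomial_function (a j)"
      "\<And>x t. f x t = (\<Sum>j\<le>N0. a j t * ts_poly \<sigma> \<nu> j x t)"
    using assms unfolding ts_expandable_def by blast
  have "\<exists>a. (\<forall>j. real_polynomial_function (a j)) \<and> (\<forall>x t. f x t = (\<Sum>j\<le>N. a j t * ts_poly \<sigma> \<nu> j x t))"
    if "N0 \<le> N" for N
  proof (intro exI conjI allI)
    let ?a = "\<lambda>j t. if j \<le> N0 then a j t else 0"
    fix j show "real_polynomial_function (?a j)"
      using a(1)[of j] rpf_const[of 0] by (cases "j \<le> N0") auto
    fix x t show "f x t = (\<Sum>j\<le>N. ?a j t * ts_poly \<sigma> \<nu> j x t)"
      unfolding a(2) by (rule sum.mono_neutral_cong_left) (use that in auto)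
  qed
  then show ?thesis by blast
qed

lemma ts_expandable_add:
  assumes "ts_expandable \<sigma> \<nu> f" "ts_expandable \<sigma> \<nu> g"
  shows "ts_expandable \<sigma> \<nu> (\<lambda>x t. f x t + g x t)"
proof -
  obtain N1 where N1: "\<And>N. N1 \<le> N \<Longrightarrow> \<exists>a. (\<forall>j. real_polynomial_function (a j)) \<and>
      (\<forall>x t. f x t = (\<Sum>j\<le>N. a j t * ts_poly \<sigma> \<nu> j x t))"
    using ts_expandable_extend[OF assms(1)] by blast
  obtain N2 where N2: "\<And>N. N2 \<le> N \<Longrightarrow> \<exists>a. (\<forall>j. real_polynomial_function (a j)) \<and>
      (\<forall>x t. g x t = (\<Sum>j\<le>N. a j t * ts_poly \<sigma> \<nu> j x t))"
    using ts_expandable_extend[OF assms(2)] by blast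
  let ?N = "max N1 N2"
  obtain a b where "\<And>j. real_polynomial_function (a j)" "\<And>x t. f x t = (\<Sum>j\<le>?N. a j t * ts_poly \<sigma> \<nu> j x t)"
    "\<And>j. real_polynomial_function (b j)" "\<And>x t. g x t = (\<Sum>j\<le>?N. b j t * ts_poly \<sigma> \<nu> j x t)"
    using N1[of ?N] N2[of ?N] by auto
  then show ?thesis
    by (intro ts_expandableI[where N = ?N and a = "\<lambda>j t. a j t + b j t"])
      (auto simp: sum.distrib distrib_right)
qed

lemma ts_expandable_sum:
  "finite I \<Longrightarrow> (\<And>i. i \<in> I \<Longrightarrow> ts_expandable \<sigma> \<nu> (f i)) \<Longrightarrow> ts_expandable \<sigma> \<nu> (\<lambda>x t. \<Sum>i\<in>I. f i x t)"
proof (induction I rule: finite_induct)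
  case empty
  show ?case
    using ts_expandable_term[OF rpf_const[of 0], of \<sigma> \<nu> 0] by simp
qed (simp add: ts_expandable_add)

lemma ts_expandable_mult_time:
  assumes "real_polynomial_function b" "ts_expandable \<sigma> \<nu> f"
  shows "ts_expandable \<sigma> \<nu> (\<lambda>x t. b t * f x t)"
proof -
  obtain N a where a: "\<And>j. real_polynomial_function (a j)"
      "\<And>x t. f x t = (\<Sum>j\<le>N. a j t * ts_poly \<sigma> \<nu> j x t)"
    using assms unfolding ts_expandable_def by blast
  then show ?thesis
    by (intro ts_expandableI[where N = N and a = "\<lambda>j t. b t * a j t"])
      (auto simp: sum_distrib_left mult.assoc assms(1))
qed

text \<open>Solved for the product of \<open>x\<close> with the \<open>n\<close>-th polynomial, the
  recurrence is itself an expansion.\<close>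

lemma ts_expandable_mult_space:
  assumes "ts_expandable \<sigma> \<nu> f"
  shows "ts_expandable \<sigma> \<nu> (\<lambda>x t. x * f x t)"
proof -
  obtain N a where a: "\<And>j. real_polynomial_function (a j)"
      "\<And>x t. f x t = (\<Sum>j\<le>N. a j t * ts_poly \<sigma> \<nu> j x t)"
    using assms unfolding ts_expandable_def by blast
  have Q: "ts_expandable \<sigma> \<nu> (\<lambda>x t. x * ts_poly \<sigma> \<nu> n x t)" for n
  proof -
    have "ts_expandable \<sigma> \<nu> (\<lambda>x t. (\<lambda>_. 1) t * ts_poly \<sigma> \<nu> (Suc n) x t +
        t * (\<Sum>j\<le>n. (\<lambda>_. real (n choose j) * cumulant \<sigma> \<nu> (Suc j)) t * ts_poly \<sigma> \<nu> (n - j) x t))"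
      by (intro ts_expandable_add ts_expandable_mult_time ts_expandable_sum ts_expandable_term
          rpf_const rpf_linear bounded_linear_ident) auto
    then show ?thesis by (simp add: ts_poly_Suc)
  qed
  have "x * f x t = (\<Sum>j\<le>N. a j t * (x * ts_poly \<sigma> \<nu> j x t))" for x t
    by (simp add: a(2) sum_distrib_left mult_ac)
  then show ?thesis
    using ts_expandable_sum[of "{..N}" \<sigma> \<nu> "\<lambda>j x t. a j t * (x * ts_poly \<sigma> \<nu> j x t)"]
      ts_expandable_mult_time[OF a(1) Q] by simp
qed

text \<open>Induction over \<open>p\<close> for arbitrary \<open>f\<close>: a product of polynomials
  acts as one multiplication after the other. Taking \<open>f\<close> to be 1 then makes
  \<open>p\<close> itself expandable.\<close>

lemma ts_expandable_mult:
  assumes "real_polynomial_function p" "ts_expandable \<sigma> \<nu> f"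
  shows "ts_expandable \<sigma> \<nu> (\<lambda>x t. p (x, t) * f x t)"
  using assms
proof (induction p arbitrary: f rule: real_polynomial_function.induct)
  case (linear p)
  \<comment> \<open>A linear form on the plane is determined by its values at the two unit
    vectors.\<close>
  have p: "p (x, t) * y = p (1, 0) * (x * y) + p (0, 1) * t * y" for x t y
  proof -
    note L = bounded_linear.linear[OF linear(1)]
    have "p (x, t) = p (x *\<^sub>R (1, 0) + t *\<^sub>R (0, 1))" by simp
    also have "\<dots> = x *\<^sub>R p (1, 0) + t *\<^sub>R p (0, 1)"
      by (simp only: linear_add[OF L] linear_scale[OF L])
    finally have "p (x, t) = x * p (1, 0) + t * p (0, 1)" by (simp only: real_scaleR_def)
    then have "p (x, t) * y = (x * p (1, 0) + t * p (0, 1)) * y" by (rule arg_cong)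
    also have "\<dots> = p (1, 0) * (x * y) + p (0, 1) * t * y"
      by (simp add: algebra_simps)
    finally show ?thesis .
  qed
  have "ts_expandable \<sigma> \<nu> (\<lambda>x t. (\<lambda>_. p (1, 0)) t * (x * f x t) + (\<lambda>t. p (0, 1) * t) t * f x t)"
  proof (rule ts_expandable_add)
    show "ts_expandable \<sigma> \<nu> (\<lambda>x t. (\<lambda>_. p (1, 0)) t * (x * f x t))"
      by (rule ts_expandable_mult_time[OF rpf_const ts_expandable_mult_space[OF linear(2)]])
    show "ts_expandable \<sigma> \<nu> (\<lambda>x t. (\<lambda>t. p (0, 1) * t) t * f x t)"
      by (rule ts_expandable_mult_time[OF rpf_mult[OF rpf_const rpf_linear[OF bounded_linear_ident]] linear(2)])
  qed
  moreover have "(\<lambda>x t. p (x, t) * f x t) = (\<lambda>x t. p (1, 0) * (x * f x t) + p (0, 1) * t * f x t)"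
    by (intro ext) (rule p)
  ultimately show ?case by (simp only:)
next
  case (const c)
  show ?case by (rule ts_expandable_mult_time[OF rpf_const const])
next
  case (add p q)
  show ?case
    using ts_expandable_add[OF add.IH(1)[OF add.prems] add.IH(2)[OF add.prems]] by (simp add: distrib_right)
next
  case (mult p q)
  show ?case using mult.IH(1)[OF mult.IH(2)[OF mult.prems]] by (simp add: mult.assoc)
qed

lemma ts_expandable_polynomial:
  assumes "real_polynomial_function (\<lambda>(x, t). f x t)"
  shows "ts_expandable \<sigma> \<nu> f"
  using ts_expandable_mult[OF assms ts_expandable_term[OF rpf_const[of 1], of \<sigma> \<nu> 0]]
  by (simp add: ts_poly_0)

text \<open>Fixing the time turns the polynomial function into a formal polynomial in
  \<open>x\<close>, which has coefficients and a degree.\<close>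

definition ts_poly_at :: "real \<Rightarrow> real measure \<Rightarrow> nat \<Rightarrow> real \<Rightarrow> real poly" where
  "ts_poly_at \<sigma> \<nu> n t = (\<Sum>j=0..n. monom (real (n choose j) * Gamma_poly (n - j) (ts_args \<sigma> \<nu> 0 t)) j)"

lemma poly_ts_poly_at: "poly (ts_poly_at \<sigma> \<nu> n t) x = ts_poly \<sigma> \<nu> n x t"
  by (simp add: ts_poly_at_def ts_poly_explicit poly_sum poly_monom)

lemma coeff_ts_poly_at:
  "coeff (ts_poly_at \<sigma> \<nu> n t) k = (if k \<le> n then real (n choose k) * Gamma_poly (n - k) (ts_args \<sigma> \<nu> 0 t) else 0)"
  by (simp add: ts_poly_at_def coeff_sum)

text \<open>Triangularity: at the largest index \<open>m\<close> with \<open>b m \<noteq> 0\<close>,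
  only the \<open>m\<close>-th polynomial contributes to the coefficient of x^m, and it is
  monic.\<close>

lemma ts_poly_at_independent:
  assumes "(\<Sum>j\<le>N. smult (b j) (ts_poly_at \<sigma> \<nu> j t)) = 0" "j \<le> N"
  shows "b j = 0"
proof (rule ccontr)
  assume "b j \<noteq> 0"
  define m where "m = Max {i. i \<le> N \<and> b i \<noteq> 0}"
  have fin: "finite {i. i \<le> N \<and> b i \<noteq> 0}" by simp
  have "m \<in> {i. i \<le> N \<and> b i \<noteq> 0}"
    unfolding m_def using \<open>b j \<noteq> 0\<close> assms(2) by (intro Max_in fin) auto
  then have m: "m \<le> N" "b m \<noteq> 0" by auto
  have max: "b i = 0" if "i \<le> N" "m < i" for i
    using Max_ge[OF fin, of i] that unfolding m_def[symmetric] by fastforce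
  have "0 = (\<Sum>j\<le>N. b j * coeff (ts_poly_at \<sigma> \<nu> j t) m)"
    using arg_cong[OF assms(1), of "\<lambda>p. coeff p m"] by (simp add: coeff_sum)
  also have "\<dots> = (\<Sum>j\<in>{m}. b j * coeff (ts_poly_at \<sigma> \<nu> j t) m)"
  proof (rule sum.mono_neutral_right)
    show "\<forall>i\<in>{..N} - {m}. b i * coeff (ts_poly_at \<sigma> \<nu> i t) m = 0"
      using max by (auto simp: coeff_ts_poly_at)
  qed (use m in auto)
  also have "\<dots> = b m" by (simp add: coeff_ts_poly_at Gamma_poly_0)
  finally show False using m by simp
qed

lemma real_polynomial_function_eq_poly:
  fixes f :: "real \<Rightarrow> real"
  assumes "real_polynomial_function f"
  shows "\<exists>p. f = poly p"
  using assms
proof (induction f rule: real_polynomial_function.induct)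
  case (linear f)
  have "f = poly [:0, f 1:]"
  proof
    fix x
    have "f (x *\<^sub>R 1) = x *\<^sub>R f 1" by (rule linear_scale[OF bounded_linear.linear[OF linear(1)]])
    then show "f x = poly [:0, f 1:] x" by simp
  qed
  then show ?case by blast
next
  case (const c)
  have "(\<lambda>x. c) = poly [:c:]" by auto
  then show ?case by blast
next
  case (add f g)
  then obtain p q where "f = poly p" "g = poly q" by blast
  then have "(\<lambda>x. f x + g x) = poly (p + q)" by auto
  then show ?case by blast
next
  case (mult f g)
  then obtain p q where "f = poly p" "g = poly q" by blast
  then have "(\<lambda>x. f x * g x) = poly (p * q)" by auto
  then show ?case by blast
qed

text \<open>The coefficients of a harmonic polynomial are compared at positive times only; this
  carries their constancy over to all real times.\<close>

lemma poly_eq_of_eventually_const: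
  fixes p :: "real poly"
  assumes "\<And>x. x > 0 \<Longrightarrow> poly p x = c"
  shows "poly p y = c"
proof -
  have "p - [:c:] = 0"
  proof (rule ccontr)
    assume "p - [:c:] \<noteq> 0"
    then have "finite {x. poly (p - [:c:]) x = 0}" by (rule poly_roots_finite)
    moreover have "{0<..} \<subseteq> {x. poly (p - [:c:]) x = 0}" using assms by auto
    ultimately have "finite {0::real<..}" by (rule finite_subset[rotated])
    then show False using infinite_Ioi by blast
  qed
  then have "p = [:c:]" by simp
  then show ?thesis by simp
qed

section \<open>Polynomials vanishing almost surely along a non-degenerate process\<close>

text \<open>The leading coefficients cancel. If the difference were zero, \<open>P\<close> would
  have period \<open>z1 - z2\<close> and take its value at 0 infinitely often, which a nonconstant
  polynomial cannot.\<close>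

lemma poly_difference_of_translates:
  fixes P :: "real poly"
  assumes P: "degree P > 0" and z: "z1 \<noteq> z2"
  defines "R \<equiv> pcompose P [:z1, 1:] - pcompose P [:z2, 1:]"
  shows "R \<noteq> 0" "degree R < degree P"
proof -
  let ?P = "\<lambda>z. pcompose P [:z, 1:]"
  have deg: "degree (?P z) = degree P" for z by (simp add: degree_pcompose)
  have lead: "coeff (?P z) (degree P) = lead_coeff P" for z
    using lead_coeff_comp[of "[:z, 1:]" P] deg[of z] by simp
  have "degree R \<le> degree P" unfolding R_def by (rule degree_diff_le) (simp_all add: deg)
  moreover have "coeff R (degree P) = 0" by (simp add: R_def lead)
  ultimately show "degree R < degree P"
    using P by (metis leading_coeff_0_iff le_neq_implies_less degree_0)
  show "R \<noteq> 0"
  proof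
    assume "R = 0"
    then have "poly (?P z1) x = poly (?P z2) x" for x by (simp add: R_def)
    then have shift: "poly P (z1 + x) = poly P (z2 + x)" for x by (simp add: poly_pcompose)
    have per: "poly P (real n * (z1 - z2)) = poly P 0" for n
    proof (induction n)
      case (Suc n)
      have "real (Suc n) * (z1 - z2) = z1 + (real n * (z1 - z2) - z2)" by (simp add: algebra_simps)
      then show ?case using shift[of "real n * (z1 - z2) - z2"] Suc by simp
    qed simp
    have "P - [:poly P 0:] \<noteq> 0"
    proof
      assume "P - [:poly P 0:] = 0"
      then have "P = [:poly P 0:]" by simp
      then have "degree P = 0" by (metis degree_pCons_0)
      with P show False by simp
    qed
    then have "finite {x. poly (P - [:poly P 0:]) x = 0}" by (rule poly_roots_finite)
    moreover have "range (\<lambda>n. real n * (z1 - z2)) \<subseteq> {x. poly (P - [:poly P 0:]) x = 0}"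
      using per by auto
    ultimately have "finite (range (\<lambda>n. real n * (z1 - z2)))" by (rule finite_subset[rotated])
    moreover have "inj (\<lambda>n. real n * (z1 - z2))" using z by (intro injI) simp
    ultimately show False using finite_imageD[of "\<lambda>n. real n * (z1 - z2)" UNIV] infinite_UNIV_nat by blast
  qed
qed

context centered_levy_process
begin

text \<open>If it vanished, x^2 would be 0 \<open>\<nu>\<close>-almost everywhere; with no mass at 0
  the measure would be zero, and \<open>\<sigma>\<close> would be 0 as well.\<close>

lemma cumulant_2_pos:
  assumes "non_degenerate \<sigma> \<nu>"
  shows "0 < cumulant \<sigma> \<nu> 2"
proof -
  have m: "0 \<le> levy_moment \<nu> 2" by (simp add: levy_moment_def)
  have "0 < \<sigma>\<^sup>2 + levy_moment \<nu> 2"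
  proof (rule ccontr)
    assume "\<not> 0 < \<sigma>\<^sup>2 + levy_moment \<nu> 2"
    then have *: "\<sigma>\<^sup>2 = 0" "levy_moment \<nu> 2 = 0" using m zero_le_power2[of \<sigma>] by linarith+
    have sets: "sets \<nu> = sets borel" and zero: "emeasure \<nu> {0} = 0"
      using levy_measure by (auto simp: levy_measure_def)
    have "AE x in \<nu>. x\<^sup>2 = 0"
      using integral_nonneg_eq_0_iff_AE[OF integrable_levy_measure_power[of 2]] *(2)
      by (simp add: levy_moment_def)
    moreover have "AE x in \<nu>. x \<notin> {0}"
      by (rule AE_not_in) (simp add: null_sets_def zero sets)
    ultimately have "AE x in \<nu>. False" by eventually_elim simp
    then have "emeasure \<nu> (space \<nu>) = 0"
      by (simp add: ae_filter_eq_bot_iff[symmetric] trivial_limit_def)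
    moreover have "space \<nu> = UNIV" using sets_eq_imp_space_eq[OF sets] by simp
    ultimately show False using assms * by (simp add: non_degenerate_def)
  qed
  then show ?thesis by (simp add: cumulant_def)
qed

text \<open>An almost sure constant would equal the mean 0, but the second moment is
  \<open>t\<close> times the positive second cumulant.\<close>

lemma not_AE_const:
  assumes "non_degenerate \<sigma> \<nu>" "0 < t"
  shows "\<not> (AE \<omega> in M. X t \<omega> = c)"
proof
  assume AE: "AE \<omega> in M. X t \<omega> = c"
  have [measurable]: "random_variable borel (X t)" using assms by (intro random_variable_X) simp
  have "expectation (X t) = expectation (\<lambda>_. c)" using AE by (intro integral_cong_AE) auto
  then have c: "c = 0" using centered assms by (simp add: centered_def prob_space)
  have "expectation (\<lambda>\<omega>. X t \<omega> ^ 2) = expectation (\<lambda>_. 0)"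
    by (rule integral_cong_AE) (use AE c in auto)
  moreover have "expectation (\<lambda>\<omega>. X t \<omega> ^ 2) = t * cumulant \<sigma> \<nu> 2"
    using expectation_power_Suc[of t 1] assms(2) by (simp add: eval_nat_numeral cumulant_def prob_space)
  ultimately show False using cumulant_2_pos[OF assms(1)] assms(2) by simp
qed

text \<open>A polynomial of minimal degree vanishing on some \<open>X\<^sub>s\<close> also vanishes on two translates of
  \<open>X\<^bsub>s/2\<^esub>\<close>, because \<open>X\<^sub>s\<close> is the sum of two independent copies of \<open>X\<^bsub>s/2\<^esub>\<close>; the difference of
  the two translated polynomials then has smaller degree.\<close>

lemma poly_AE_zero_imp_zero:
  assumes nd: "non_degenerate \<sigma> \<nu>" and "0 < s" "AE \<omega> in M. poly P (X s \<omega>) = 0"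
  shows "P = 0"
  using assms(2,3)
proof (induction "degree P" arbitrary: P s rule: less_induct)
  case less
  show ?case
  proof (cases "degree P = 0")
    case True
    then obtain c where P: "P = [:c:]" by (rule degree_eq_zeroE)
    then have "AE \<omega> in M. c = 0" using less.prems(2) by simp
    then show ?thesis using P by (simp add: AE_const)
  next
    case False
    let ?u = "s / 2"
    have u: "0 \<le> ?u" "?u < s" "0 < ?u" using less.prems(1) by auto
    let ?Y = "X ?u" and ?Z = "\<lambda>\<omega>. X s \<omega> - X ?u \<omega>"
    have ind: "indep_var borel ?Y borel ?Z"
      by (rule indep_var_filtration_increment[OF u(1,2)]) (use u in \<open>auto intro: measurable_filtration\<close>)
    have [measurable]: "random_variable borel ?Y" "random_variable borel (X s)"
      using u less.prems(1) by (auto intro: random_variable_X)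
    have [measurable]: "poly P \<in> borel_measurable borel"
      by (intro borel_measurable_continuous_onI continuous_intros)
    have D: "distr M borel ?Z = distr M borel ?Y"
      using stationary_increments[of ?u s] u by simp
    let ?D = "distr M borel ?Y"
    interpret D: prob_space ?D by (rule prob_space_distr) simp
    interpret DD: pair_sigma_finite ?D ?D ..
    \<comment> \<open>Independence makes the joint law of the two halves a product and stationarity
      identifies the factors, so a null set can be sliced.\<close>
    have "?D \<Otimes>\<^sub>M ?D = distr M (borel \<Otimes>\<^sub>M borel) (\<lambda>\<omega>. (?Y \<omega>, ?Z \<omega>))"
      using ind unfolding indep_var_distribution_eq D by simp
    moreover have "AE p in distr M (borel \<Otimes>\<^sub>M borel) (\<lambda>\<omega>. (?Y \<omega>, ?Z \<omega>)). poly P (fst p + snd p) = 0"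
    proof (subst AE_distr_iff)
      show "AE \<omega> in M. poly P (fst (?Y \<omega>, ?Z \<omega>) + snd (?Y \<omega>, ?Z \<omega>)) = 0"
        using less.prems(2) by simp
    qed measurable
    ultimately have "AE p in ?D \<Otimes>\<^sub>M ?D. poly P (fst p + snd p) = 0" by (simp only:)
    then have "AE z in ?D. AE y in ?D. poly P (fst (z, y) + snd (z, y)) = 0"
      by (rule DD.AE_pair)
    then have "AE z in ?D. AE \<omega> in M. poly P (z + ?Y \<omega>) = 0"
      by (simp add: AE_distr_iff)
    then have W: "AE \<omega>' in M. AE \<omega> in M. poly P (?Y \<omega>' + ?Y \<omega>) = 0"
      by (rule AE_distrD[rotated]) simp
    define W where "W = {z. AE \<omega> in M. poly P (z + ?Y \<omega>) = 0}"
    \<comment> \<open>\<open>X (s / 2)\<close> lies in \<open>W\<close> almost surely, so a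
      \<open>W\<close> with at most one point would make it almost surely constant.\<close>
    have "\<exists>z1\<in>W. \<exists>z2\<in>W. z1 \<noteq> z2"
    proof (rule ccontr)
      assume "\<not> (\<exists>z1\<in>W. \<exists>z2\<in>W. z1 \<noteq> z2)"
      then have "W \<subseteq> {SOME z. z \<in> W}" by (metis someI singletonI subsetI)
      with W have "AE \<omega> in M. ?Y \<omega> = (SOME z. z \<in> W)"
        by (auto simp: W_def elim!: eventually_mono)
      then show False using not_AE_const[OF nd u(3)] by blast
    qed
    then obtain z1 z2 where z: "z1 \<in> W" "z2 \<in> W" "z1 \<noteq> z2" by blast
    let ?R = "pcompose P [:z1, 1:] - pcompose P [:z2, 1:]"
    have R: "?R \<noteq> 0" "degree ?R < degree P"
      using poly_difference_of_translates[of P z1 z2] False z(3) by auto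
    have "AE \<omega> in M. poly P (z1 + ?Y \<omega>) = 0" "AE \<omega> in M. poly P (z2 + ?Y \<omega>) = 0"
      using z by (auto simp: W_def)
    then have "AE \<omega> in M. poly ?R (?Y \<omega>) = 0"
      by eventually_elim (simp add: poly_pcompose)
    from less.hyps[OF R(2) u(3) this] R(1) show ?thesis by simp
  qed
qed

lemma time_space_harmonic_in_span:
  assumes nd: "non_degenerate \<sigma> \<nu>" and f: "time_space_harmonic M X f"
  shows "f \<in> fun2.span (range Q)"
proof -
  have "ts_expandable \<sigma> \<nu> f"
    using time_space_harmonicD(1)[OF f] by (rule ts_expandable_polynomial)
  then obtain N a where a: "\<And>j. real_polynomial_function (a j)"
      "\<And>x t. f x t = (\<Sum>j\<le>N. a j t * Q j x t)"
    unfolding ts_expandable_def by blast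
  have const: "a j t = a j s" if st: "0 < s" "s \<le> t" and j: "j \<le> N" for s t j
  proof -
    \<comment> \<open>Freezing the coefficients at time \<open>t\<close> gives a harmonic polynomial
      that agrees with \<open>f\<close> at \<open>t\<close>; both therefore have the same
      conditional expectation at \<open>s\<close>.\<close>
    let ?g = "\<lambda>x r. \<Sum>j\<le>N. a j t * Q j x r"
    have g: "time_space_harmonic M X ?g"
      using ts_poly_combination_in_span[where c = "\<lambda>j. a j t"] span_ts_poly_subset by blast
    have "AE \<omega> in M. real_cond_exp M (filtration s) (\<lambda>\<omega>. f (X t \<omega>) t) \<omega> = f (X s \<omega>) s"
      using time_space_harmonicD(4)[OF f, of s t] st by simp
    moreover have "AE \<omega> in M. real_cond_exp M (filtration s) (\<lambda>\<omega>. ?g (X t \<omega>) t) \<omega> = ?g (X s \<omega>) s"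
      using time_space_harmonicD(4)[OF g, of s t] st by simp
    ultimately have "AE \<omega> in M. f (X s \<omega>) s = ?g (X s \<omega>) s"
      unfolding a(2) by eventually_elim simp
    then have "AE \<omega> in M. poly (\<Sum>j\<le>N. smult (a j t - a j s) (ts_poly_at \<sigma> \<nu> j s)) (X s \<omega>) = 0"
      by eventually_elim (simp add: a(2) poly_sum poly_ts_poly_at left_diff_distrib sum_subtractf)
    then have "(\<Sum>j\<le>N. smult (a j t - a j s) (ts_poly_at \<sigma> \<nu> j s)) = 0"
      by (rule poly_AE_zero_imp_zero[OF nd st(1)])
    from ts_poly_at_independent[OF this j] show ?thesis by simp
  qed
  \<comment> \<open>Constancy at positive times, with 1 as reference, extends to all
    \<open>t\<close> because the coefficients are polynomials.\<close>
  have "a j t = a j 1" if j: "j \<le> N" for j t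
  proof -
    obtain p where p: "a j = poly p" using real_polynomial_function_eq_poly[OF a(1)] by blast
    have "a j r = a j 1" if "r > 0" for r
    proof (cases "r \<le> 1")
      case True
      show ?thesis using const[OF that True j] by (rule sym)
    next
      case False
      then show ?thesis by (intro const j) auto
    qed
    then show ?thesis unfolding p by (rule poly_eq_of_eventually_const)
  qed
  then have "f x t = (\<Sum>j\<le>N. a j 1 * Q j x t)" for x t
    unfolding a(2) by (intro sum.cong refl) (metis atMost_iff)
  then have "f = (\<lambda>x t. \<Sum>j\<le>N. a j 1 * Q j x t)" by (intro ext)
  then show ?thesis using ts_poly_combination_in_span by (simp only:)
qed

end

theorem corollary2:
  fixes M :: "'a measure" and X :: "real \<Rightarrow> 'a \<Rightarrow> real"
    and \<gamma> \<sigma> :: real and \<nu> :: "real measure"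
  assumes levy: "levy_process M X"
    and centered: "centered M X"
    and moments: "finite_moments M X"
    and triplet: "has_levy_triplet M X \<gamma> \<sigma> \<nu>"
  shows "(\<forall>n\<ge>1. time_space_harmonic M X (ts_poly \<sigma> \<nu> n)) \<and>
    (\<forall>n x t. ts_poly \<sigma> \<nu> (n + 1) x t =
       x * ts_poly \<sigma> \<nu> n x t
       - real n * (levy_moment \<nu> 2 + \<sigma>\<^sup>2) * t * ts_poly \<sigma> \<nu> (n - 1) x t
       - (\<Sum>j=2..n. real (n choose j) * levy_moment \<nu> (j + 1) * t * ts_poly \<sigma> \<nu> (n - j) x t)) \<and>
    (\<forall>n\<ge>1. \<forall>t\<ge>0. \<forall>\<omega>\<in>space M. ts_poly \<sigma> \<nu> n (X t \<omega>) t =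
       (\<Sum>j=0..n. real (n choose j) * Gamma_poly (n - j) (ts_args \<sigma> \<nu> 0 t) * X t \<omega> ^ j)) \<and>
    (non_degenerate \<sigma> \<nu> \<longrightarrow>
       fun2.span (range (ts_poly \<sigma> \<nu>)) = {Q. time_space_harmonic M X Q})"
proof -
  interpret levy_process M X by (rule levy)
  interpret centered_levy_process M X \<gamma> \<sigma> \<nu>
    by unfold_locales (rule centered moments triplet)+
  show ?thesis
  proof (intro conjI allI impI ballI)
    assume "non_degenerate \<sigma> \<nu>"
    then show "fun2.span (range (ts_poly \<sigma> \<nu>)) = {Q. time_space_harmonic M X Q}"
      using time_space_harmonic_in_span by (intro equalityI span_ts_poly_subset) blast
  qed (rule time_space_harmonic_ts_poly ts_poly_recurrence ts_poly_explicit)+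
qed

end
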